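(* Let $\alpha$ be a fixed real number with $\frac16\le\alpha\le \frac{52-16\sqrt{3}}{121}$, and let $$p=\frac{1-\sqrt{\alpha(3-2\alpha)}}{1-2\alpha}.$$ Then for all sufficiently large $n$, $$r(B_{\lceil\alpha n\rceil}, B_n)\ge\frac{3n}{1+2p^2}-o(n).$$ Moreover, the inequality is asymptotically tight when $\alpha=1/6$, i.e., for $\alpha=1/6$ one has $r(B_{\lceil\alpha n\rceil}, B_n)=\frac{3n}{1+2p^2}+o(n)$. Here $o(n)$ denotes a quantity whose ratio to $n$ tends to $0$ as $n\to\infty$ with $\alpha$ fixed.
   Context: For graphs $G$ and $H$, the Ramsey number $r(G,H)$ is the smallest positive integer $N$ such that any red/blue edge coloring of the complete graph $K_N$ contains either a red copy of $G$ or a blue copy of $H$ (as a not necessarily induced subgraph). The book $B_m$ is the graph consisting of $m$ triangles all sharing a common edge (so it has $m+2$ vertices). The paper omits ceiling signs, writing $B_{\alpha n}$ for $B_{\lceil\alpha n\rceil}$. Numerically, $\frac{52-16\sqrt{3}}{121}\approx 0.2007$. *)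

theory Defs
  imports
    "HOL-Analysis.Analysis"
    "HOL-Library.Landau_Symbols"
    "HOL-Library.Ramsey"
begin

type_synonym 'a sgraph = "'a set \<times> 'a set set"

abbreviation verts :: "'a sgraph \<Rightarrow> 'a set" where "verts \<equiv> fst"
abbreviation edges :: "'a sgraph \<Rightarrow> 'a set set" where "edges \<equiv> snd"

definition fin_simple_graph :: "'a sgraph \<Rightarrow> bool" where
  "fin_simple_graph G \<longleftrightarrow> finite (verts G) \<and> edges G \<subseteq> [verts G]\<^bsup>2\<^esup>"

(* a copy of G in H, as a not necessarily induced subgraph *)
definition has_copy :: "'a sgraph \<Rightarrow> 'b sgraph \<Rightarrow> bool" where
  "has_copy G H \<longleftrightarrow>
     (\<exists>f. inj_on f (verts G) \<and> f ` verts G \<subseteq> verts H \<and> (\<forall>e\<in>edges G. f ` e \<in> edges H))"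

definition complete_graph :: "nat \<Rightarrow> nat sgraph" where
  "complete_graph N = ({..<N}, [{..<N}]\<^bsup>2\<^esup>)"

datatype colour = Red | Blue

definition colour_class :: "'a sgraph \<Rightarrow> ('a set \<Rightarrow> colour) \<Rightarrow> colour \<Rightarrow> 'a sgraph" where
  "colour_class K c x = (verts K, {e \<in> edges K. c e = x})"

definition arrows :: "nat \<Rightarrow> 'a sgraph \<Rightarrow> 'b sgraph \<Rightarrow> bool" where
  "arrows N G H \<longleftrightarrow>
     (\<forall>c. has_copy G (colour_class (complete_graph N) c Red) \<or>
          has_copy H (colour_class (complete_graph N) c Blue))"

definition ramsey_number :: "'a sgraph \<Rightarrow> 'b sgraph \<Rightarrow> nat" where
  "ramsey_number G H = (LEAST N. N > 0 \<and> arrows N G H)"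

(* the common edge is {0, 1}; the apexes of the m triangles are 2, ..., m + 1 *)
definition book :: "nat \<Rightarrow> nat sgraph" where
  "book m = ({..<m + 2}, {{0, 1}} \<union> (\<Union>i\<in>{2..<m + 2}. {{0, i}, {1, i}}))"

lemma fin_simple_graph_book: "fin_simple_graph (book m)"
  by (auto simp: fin_simple_graph_def book_def)

lemma has_copy_of_clique:
  assumes G: "fin_simple_graph G" and R: "R \<subseteq> verts H" "card R = card (verts G)" "finite R"
    and sub: "[R]\<^bsup>2\<^esup> \<subseteq> edges H"
  shows "has_copy G H"
proof -
  have "finite (verts G)" and E: "edges G \<subseteq> [verts G]\<^bsup>2\<^esup>"
    using G by (auto simp: fin_simple_graph_def)
  then obtain f where f: "bij_betw f (verts G) R"
    using R finite_same_card_bij by metis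
  have "f ` e \<in> edges H" if "e \<in> edges G" for e
  proof -
    obtain x y where xy: "e = {x, y}" "x \<in> verts G" "y \<in> verts G" "x \<noteq> y"
      using E \<open>e \<in> edges G\<close> by (meson nsets2_E subsetD)
    then have "f x \<in> R" "f y \<in> R" "f x \<noteq> f y"
      using f by (auto simp: bij_betw_def inj_on_def)
    then have "{f x, f y} \<in> [R]\<^bsup>2\<^esup>" by simp
    with sub xy show ?thesis by auto
  qed
  with f R show ?thesis
    unfolding has_copy_def bij_betw_def by blast
qed

(* the LEAST in ramsey_number ranges over a nonempty set, by Ramsey's theorem *)
lemma ramsey_number_exists:
  assumes G: "fin_simple_graph G" and H: "fin_simple_graph H"
  shows "\<exists>N>0. arrows N G H"
proof -
  obtain N :: nat where "N \<ge> 1" and N: "\<forall>(V::nat set) E. finite V \<and> card V \<ge> N \<longrightarrow>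
    (\<exists>R \<subseteq> V. card R = card (verts G) \<and> clique R E \<or> card R = card (verts H) \<and> indep R E)"
    using ramsey2 by metis
  have "arrows N G H"
    unfolding arrows_def
  proof
    fix c :: "nat set \<Rightarrow> colour"
    obtain R where R: "R \<subseteq> {..<N}"
      and alt: "card R = card (verts G) \<and> clique R {e. c e = Red} \<or>
                card R = card (verts H) \<and> indep R {e. c e = Red}"
      using N[rule_format, of "{..<N}" "{e. c e = Red}"] by auto
    have fin: "finite R" using R finite_subset by blast
    have edge: "e \<in> [{..<N}]\<^bsup>2\<^esup>" if "e \<in> [R]\<^bsup>2\<^esup>" for e
      using that nsets_mono[OF R] by blast
    from alt show "has_copy G (colour_class (complete_graph N) c Red) \<or>
          has_copy H (colour_class (complete_graph N) c Blue)"
    proof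
      assume a: "card R = card (verts G) \<and> clique R {e. c e = Red}"
      have "c e = Red" if "e \<in> [R]\<^bsup>2\<^esup>" for e
        using a that by (auto simp: clique_def elim!: nsets2_E)
      then have "[R]\<^bsup>2\<^esup> \<subseteq> edges (colour_class (complete_graph N) c Red)"
        using edge by (auto simp: colour_class_def complete_graph_def)
      then show ?thesis
        using has_copy_of_clique[OF G, of R "colour_class (complete_graph N) c Red"] a R fin
        by (auto simp: colour_class_def complete_graph_def)
    next
      assume a: "card R = card (verts H) \<and> indep R {e. c e = Red}"
      have "c e = Blue" if "e \<in> [R]\<^bsup>2\<^esup>" for e
        using a that by (cases "c e") (auto simp: indep_def elim!: nsets2_E)
      then have "[R]\<^bsup>2\<^esup> \<subseteq> edges (colour_class (complete_graph N) c Blue)"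
        using edge by (auto simp: colour_class_def complete_graph_def)
      then show ?thesis
        using has_copy_of_clique[OF H, of R "colour_class (complete_graph N) c Blue"] a R fin
        by (auto simp: colour_class_def complete_graph_def)
    qed
  qed
  with \<open>N \<ge> 1\<close> show ?thesis by (intro exI[of _ N]) auto
qed

end

theory Submission
  imports Defs "HOL-Probability.Hoeffding" "HOL-Real_Asymp.Real_Asymp"
begin

text \<open>
  A colouring of \<open>K\<^sub>N\<close> avoids both books exactly if every red edge has fewer than \<open>\<alpha>n\<close> common red
  neighbours and every blue edge fewer than \<open>n\<close> common blue ones (\<open>has_copy_book_iff\<close>).

  \<^bold>\<open>Lower bound.\<close> Split \<open>3m\<close> vertices into three parts of size \<open>m\<close>, colour the inside of each part
  blue, and colour every edge between two parts blue with probability \<open>p\<close>, independently. Up to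
  \<open>o(m)\<close>, an edge inside a part has \<open>m + 2p\<^sup>2m\<close> common blue neighbours, a blue edge between two parts
  has \<open>2pm + p\<^sup>2m\<close>, which is not more since \<open>(1 - p)\<^sup>2 \<ge> 0\<close>, and a red edge has \<open>(1 - p)\<^sup>2m\<close> common
  red ones, all in the third part. The given \<open>p\<close> is the solution of \<open>(1 - p)\<^sup>2 = \<alpha>(1 + 2p\<^sup>2)\<close>, so
  \<open>m = n/(1 + 2p\<^sup>2)\<close>, slightly reduced, satisfies both constraints at once. Hoeffding's inequality
  and a union bound over all pairs make this rigorous (\<open>three_part_colouring\<close>).

  \<^bold>\<open>Upper bound for \<open>\<alpha> = 1/6\<close>.\<close> Here \<open>p = 1/2\<close>, and the claim is that the Ramsey number is at most
  \<open>(2 + o(1))n\<close>. Suppose that every red edge has at most \<open>(1/12 - \<delta>)N\<close> common red neighbours and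
  every blue edge at most \<open>(1/2 - \<delta>)N\<close> common blue ones. For a large monochromatic clique \<open>Q\<close> let
  \<open>f\<^sub>Q(z)\<close> be the proportion of \<open>Q\<close> that \<open>z\<close> sends red edges to. Averaging the hypothesis over the
  edges of a clique, or over the edges between two cliques joined in a single colour, bounds the sums
  of \<open>f\<^sub>Q\<^sup>2\<close>, \<open>(1 - f\<^sub>Q)\<^sup>2\<close> and of the corresponding products, and so sums of squares become
  contradictions:
  \<^item> Three blue cliques with only red edges between them cannot exist, as the sum of
    \<open>(f\<^sub>1 + f\<^sub>2 + f\<^sub>3 - 1)\<^sup>2\<close> would be negative (\<open>no_three_blue_cliques\<close>).
  \<^item> Two blue cliques with only red edges between them satisfy
    \<open>\<Sum> (f\<^sub>1 + f\<^sub>2 - 1)\<^sup>2 + \<delta>N \<le> 2 \<Sum> f\<^sub>1f\<^sub>2\<close> (\<open>blue_red_blue_sum\<close>).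
  \<^item> Two red cliques with only blue edges between them cannot exist (\<open>no_two_red_cliques\<close>).

  Remove disjoint red cliques of a large fixed size as long as possible; let \<open>Z\<close> be their union and
  \<open>Y\<close> the rest. By Ramsey's theorem every large subset of \<open>Y\<close> contains a large blue clique. Take two
  blue cliques in \<open>Y\<close> with red edges between them. If many vertices of \<open>Y\<close> were red to much of both,
  then some would form a third blue clique, a contradiction; so the sum of \<open>f\<^sub>1f\<^sub>2\<close> is essentially
  over \<open>Z\<close>, and the inequality above says that the two cliques have many red edges into \<open>Z\<close>: if these
  have densities \<open>d\<^sub>1\<close> and \<open>d\<^sub>2\<close>, then \<open>(1 - d\<^sub>1)\<^sup>2 + (1 - d\<^sub>2)\<^sup>2 < 1\<close> (\<open>red_degrees_into_Z\<close>; if \<open>Z\<close> is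
  empty, this is already absurd). Choose the first clique among the vertices of \<open>Y\<close> with the fewest red
  edges into \<open>Z\<close>. Unless even these have red density above \<open>1 - 1/\<surd>2\<close> into \<open>Z\<close>, at least half of
  \<open>Y\<close> has red edges to that clique, and so in any case the red density between \<open>Y\<close> and \<open>Z\<close> is at
  least \<open>1 - 1/\<surd>2\<close>, up to \<open>O(1/|Y|)\<close> (\<open>sum_deg_Z_lower_bound\<close>). So some red clique \<open>P\<close> in \<open>Z\<close> has mean
  \<open>f\<^sub>P\<close> at least that large on \<open>Y\<close>, and it is joined to \<open>Z\<close> mostly in red. Since
  \<open>(1 - 1/\<surd>2)\<^sup>2 > 1/12\<close>, the sum of \<open>f\<^sub>P\<^sup>2\<close> is at least \<open>N/12 - O(1)\<close>, which for large \<open>N\<close> exceeds the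
  bound \<open>(1/12 - \<delta>/2)N\<close> for red cliques (\<open>bounded_size\<close>).
\<close>

section \<open>Books and arrows\<close>

definition codegree :: "'a sgraph \<Rightarrow> 'a \<Rightarrow> 'a \<Rightarrow> nat" where
  "codegree H x y = card {z. {x, z} \<in> edges H \<and> {y, z} \<in> edges H}"

lemma fin_simple_graph_colour_class_complete:
  "fin_simple_graph (colour_class (complete_graph N) c a)"
  by (auto simp: fin_simple_graph_def colour_class_def complete_graph_def)

lemma edges_colour_class_complete:
  "{x, y} \<in> edges (colour_class (complete_graph N) c a) \<longleftrightarrow>
     x < N \<and> y < N \<and> x \<noteq> y \<and> c {x, y} = a"
  by (auto simp: colour_class_def complete_graph_def)

lemma fin_simple_graph_edgeD:
  assumes "fin_simple_graph H" "{x, y} \<in> edges H"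
  shows "x \<noteq> y" "x \<in> verts H" "y \<in> verts H"
proof -
  have "{x, y} \<in> [verts H]\<^bsup>2\<^esup>" using assms by (auto simp: fin_simple_graph_def simp del: doubleton_in_nsets_2)
  then show "x \<noteq> y" "x \<in> verts H" "y \<in> verts H" by simp_all
qed

lemma has_copy_book_iff:
  assumes H: "fin_simple_graph H"
  shows "has_copy (book m) H \<longleftrightarrow> (\<exists>x y. {x, y} \<in> edges H \<and> m \<le> codegree H x y)"
proof
  assume "has_copy (book m) H"
  then obtain f where inj: "inj_on f {..<m + 2}" and E: "\<forall>e\<in>edges (book m). f ` e \<in> edges H"
    by (auto simp: has_copy_def book_def)
  have "f ` {0, 1} \<in> edges H" using E by (auto simp: book_def)
  moreover have "m \<le> codegree H (f 0) (f 1)"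
  proof -
    have "f ` {0, i} \<in> edges H \<and> f ` {1, i} \<in> edges H" if "i \<in> {2..<m + 2}" for i
      using E that by (auto simp: book_def)
    then have sub: "f ` {2..<m + 2} \<subseteq> {z. {f 0, z} \<in> edges H \<and> {f 1, z} \<in> edges H}"
      by auto
    have "finite {z. {f 0, z} \<in> edges H \<and> {f 1, z} \<in> edges H}"
      by (rule finite_subset[of _ "verts H"])
        (use H fin_simple_graph_edgeD[OF H] in \<open>auto simp: fin_simple_graph_def\<close>)
    moreover have "card (f ` {2..<m + 2}) = m"
      using inj by (subst card_image) (auto intro: inj_on_subset)
    ultimately show ?thesis
      unfolding codegree_def using card_mono[OF _ sub] by simp
  qed
  ultimately show "\<exists>x y. {x, y} \<in> edges H \<and> m \<le> codegree H x y"
    by (metis image_insert image_empty)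
next
  assume "\<exists>x y. {x, y} \<in> edges H \<and> m \<le> codegree H x y"
  then obtain x y where xy: "{x, y} \<in> edges H" and m: "m \<le> codegree H x y" by blast
  then obtain S where S: "S \<subseteq> {z. {x, z} \<in> edges H \<and> {y, z} \<in> edges H}" "card S = m" "finite S"
    unfolding codegree_def by (meson obtain_subset_with_card_n)
  have xyS: "x \<noteq> y" "x \<notin> S" "y \<notin> S" "insert x (insert y S) \<subseteq> verts H"
    using S fin_simple_graph_edgeD[OF H] xy by blast+
  obtain g where g: "bij_betw g {2..<m + 2} S"
    using S by (metis add_diff_cancel_right' card_atLeastLessThan finite_atLeastLessThan
        finite_same_card_bij)
  define f where "f i = (if i = 0 then x else if i = 1 then y else g i)" for i :: nat
  have f01: "f 0 = x" "f (Suc 0) = y" by (simp_all add: f_def)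
  have gS: "g i \<in> S" if "i \<in> {2..<m + 2}" for i
    using g that by (auto simp: bij_betw_def)
  have fg: "f i = g i" if "i \<in> {2..<m + 2}" for i using that by (auto simp: f_def)
  have V: "{..<m + 2} = {0, 1} \<union> {2..<m + 2}" by auto
  have injg: "inj_on f {2..<m + 2}"
    using g fg by (subst inj_on_cong[of _ f g]) (auto simp: bij_betw_def)
  have "inj_on f {..<m + 2}"
    unfolding V
  proof (subst inj_on_Un, intro conjI injg)
    show "inj_on f {0, 1}" using xyS by (auto simp: f_def inj_on_def)
    have "f i \<in> S" if "i \<in> {2..<m + 2}" for i using gS fg that by auto
    then show "f ` ({0, 1} - {2..<m + 2}) \<inter> f ` ({2..<m + 2} - {0, 1}) = {}"
      using xyS by (auto simp: f_def)
  qed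
  moreover have "f ` {..<m + 2} \<subseteq> verts H"
    using xyS gS by (auto simp: f_def)
  moreover have "f ` e \<in> edges H" if "e \<in> edges (book m)" for e
  proof -
    from that consider "e = {0, 1}" | i where "i \<in> {2..<m + 2}" "e = {0, i} \<or> e = {1, i}"
      by (auto simp: book_def)
    then show ?thesis
    proof cases
      case 1 then show ?thesis using xy f01 by simp
    next
      case 2
      then have "f i \<in> S" using gS fg by auto
      then have "{x, f i} \<in> edges H" "{y, f i} \<in> edges H" using S by auto
      then show ?thesis using 2 f01 by auto
    qed
  qed
  ultimately show "has_copy (book m) H"
    unfolding has_copy_def by (intro exI[of _ f]) (simp add: book_def)
qed

lemma has_copy_mono:
  assumes "has_copy G H" "verts H \<subseteq> verts H'" "edges H \<subseteq> edges H'"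
  shows "has_copy G H'"
proof -
  obtain f where "inj_on f (verts G)" "f ` verts G \<subseteq> verts H" "\<forall>e\<in>edges G. f ` e \<in> edges H"
    using assms(1) unfolding has_copy_def by blast
  then show ?thesis
    unfolding has_copy_def using assms(2,3) by (intro exI[of _ f]) blast
qed

lemma has_copy_colour_class_mono:
  assumes "has_copy F (colour_class (complete_graph N) c a)" "N \<le> N'"
  shows "has_copy F (colour_class (complete_graph N') c a)"
  by (rule has_copy_mono[OF assms(1)])
    (use nsets_mono[of "{..<N}" "{..<N'}" 2] assms(2) in
      \<open>auto simp: colour_class_def complete_graph_def\<close>)

lemma arrows_mono: "arrows N G H \<Longrightarrow> N \<le> N' \<Longrightarrow> arrows N' G H"
  unfolding arrows_def by (metis has_copy_colour_class_mono)

lemma ramsey_number_le: "N > 0 \<Longrightarrow> arrows N G H \<Longrightarrow> ramsey_number G H \<le> N"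
  unfolding ramsey_number_def by (rule Least_le) simp

lemma less_ramsey_number:
  assumes "fin_simple_graph G" "fin_simple_graph H" "\<not> arrows N G H"
  shows "N < ramsey_number G H"
proof -
  have "arrows (ramsey_number G H) G H"
    unfolding ramsey_number_def
    using LeastI_ex[OF ramsey_number_exists[OF assms(1,2)]] by simp
  then have "arrows N G H" if "ramsey_number G H \<le> N" using that by (rule arrows_mono)
  then show ?thesis using assms(3) by linarith
qed

lemma not_arrows_booksI:
  assumes "\<And>x y. x < N \<Longrightarrow> y < N \<Longrightarrow> x \<noteq> y \<Longrightarrow> c {x, y} = Red \<Longrightarrow>
             card {z. z < N \<and> z \<noteq> x \<and> z \<noteq> y \<and> c {x, z} = Red \<and> c {y, z} = Red} < a"
    and "\<And>x y. x < N \<Longrightarrow> y < N \<Longrightarrow> x \<noteq> y \<Longrightarrow> c {x, y} = Blue \<Longrightarrow>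
             card {z. z < N \<and> z \<noteq> x \<and> z \<noteq> y \<and> c {x, z} = Blue \<and> c {y, z} = Blue} < b"
  shows "\<not> arrows N (book a) (book b)"
proof -
  have *: "codegree (colour_class (complete_graph N) c a) x y =
     card {z. z < N \<and> z \<noteq> x \<and> z \<noteq> y \<and> c {x, z} = a \<and> c {y, z} = a}"
    if "x < N" "y < N" for x y a
    unfolding codegree_def edges_colour_class_complete using that
    by (intro arg_cong[of _ _ card]) auto
  have no_copy: "\<not> has_copy (book m) (colour_class (complete_graph N) c a)"
    if "\<And>x y. x < N \<Longrightarrow> y < N \<Longrightarrow> x \<noteq> y \<Longrightarrow> c {x, y} = a \<Longrightarrow>
      card {z. z < N \<and> z \<noteq> x \<and> z \<noteq> y \<and> c {x, z} = a \<and> c {y, z} = a} < m" for a m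
  proof
    assume "has_copy (book m) (colour_class (complete_graph N) c a)"
    then obtain x y where xy: "x < N" "y < N" "x \<noteq> y" "c {x, y} = a"
      and "m \<le> codegree (colour_class (complete_graph N) c a) x y"
      unfolding has_copy_book_iff[OF fin_simple_graph_colour_class_complete]
        edges_colour_class_complete by blast
    then show False using that[OF xy] *[OF xy(1,2)] by simp
  qed
  have "\<not> has_copy (book a) (colour_class (complete_graph N) c Red)"
    by (rule no_copy) (rule assms(1))
  moreover have "\<not> has_copy (book b) (colour_class (complete_graph N) c Blue)"
    by (rule no_copy) (rule assms(2))
  ultimately show ?thesis unfolding arrows_def by blast
qed

section \<open>Random graphs with concentrated common neighbourhoods\<close>

text \<open>
  For distinct \<open>w\<close> outside \<open>S\<close> the edge sets between \<open>w\<close> and \<open>S\<close> are disjoint, so the events that \<open>w\<close>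
  is joined to all of \<open>S\<close> by edges of value \<open>\<beta>\<close> are independent, and Hoeffding's inequality applies
  to their number. Sets \<open>S\<close> of size one and two give degrees and codegrees.
\<close>
lemma prob_common_neighbours_exceed:
  fixes p t :: real and V :: "'a set"
  assumes V: "finite V" "S \<subseteq> V" "W \<subseteq> V"
    and p: "0 \<le> p" "p \<le> 1" and W: "card W \<le> m" "m > 0" and t: "t > 0"
  shows "measure_pmf.prob (Pi_pmf ([V]\<^bsup>2\<^esup>) False (\<lambda>_. bernoulli_pmf p))
          {\<omega>. pmf (bernoulli_pmf p) \<beta> ^ card S * m + t
               \<le> real (card {w \<in> W - S. \<forall>x\<in>S. \<omega> {x, w} = \<beta>})}
        \<le> exp (- 2 * t\<^sup>2 / m)"
proof (cases "W - S = {}")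
  case True
  have "0 \<le> pmf (bernoulli_pmf p) \<beta> ^ card S * m" by simp
  then have "\<not> pmf (bernoulli_pmf p) \<beta> ^ card S * m + t \<le> 0" using t by linarith
  moreover have "{w \<in> W - S. \<forall>x\<in>S. \<omega> {x, w} = \<beta>} = {}" for \<omega> using True by auto
  ultimately show ?thesis by (simp only: card.empty of_nat_0) simp
next
  case False
  define P where "P = Pi_pmf ([V]\<^bsup>2\<^esup>) False (\<lambda>_. bernoulli_pmf p)"
  define q where "q = pmf (bernoulli_pmf p) \<beta>"
  define I where "I = W - S"
  define J where "J w = (\<lambda>x. {x, w}) ` S" for w
  define X :: "'a \<Rightarrow> ('a set \<Rightarrow> bool) \<Rightarrow> real" where
    "X w \<omega> = (if \<forall>e\<in>J w. \<omega> e = \<beta> then 1 else 0)" for w \<omega>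
  have fin: "finite I" "finite S" using V by (auto simp: I_def intro: finite_subset)
  have finE: "finite ([V]\<^bsup>2\<^esup>)" using V by (simp add: finite_imp_finite_nsets)
  have JE: "J w \<subseteq> [V]\<^bsup>2\<^esup>" if "w \<in> I" for w
    using that V by (auto simp: J_def I_def)
  have finJ: "finite (J w)" for w using fin by (simp add: J_def)
  have disj: "disjoint_family_on J I"
    by (auto simp: disjoint_family_on_def J_def I_def doubleton_eq_iff)
  have "prob_space.indep_vars (measure_pmf P) (\<lambda>_. count_space UNIV) (\<lambda>e \<omega>. \<omega> e) ([V]\<^bsup>2\<^esup>)"
    unfolding P_def by (rule indep_vars_Pi_pmf[OF finE])
  then have "prob_space.indep_vars (measure_pmf P) (\<lambda>w. PiM (J w) (\<lambda>_. count_space UNIV)) (\<lambda>w \<omega>. restrict (\<lambda>e. \<omega> e) (J w)) I"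
    by (rule prob_space.indep_vars_restrict[OF measure_pmf.prob_space_axioms _ JE disj])
  then have "prob_space.indep_vars (measure_pmf P) (\<lambda>_. borel)
      (\<lambda>w \<omega>. (if \<forall>e\<in>J w. restrict (\<lambda>e. \<omega> e) (J w) e = \<beta> then 1 else 0::real)) I"
    by (rule prob_space.indep_vars_compose2[OF measure_pmf.prob_space_axioms, where Y = "\<lambda>w g. if \<forall>e\<in>J w. g e = \<beta> then 1 else 0::real"])
      (use finJ in measurable)
  then have indep: "prob_space.indep_vars (measure_pmf P) (\<lambda>_. borel) X I"
    by (rule prob_space.indep_vars_cong[OF measure_pmf.prob_space_axioms, THEN iffD1, rotated 3]) (auto simp: X_def fun_eq_iff)
  have E: "measure_pmf.expectation P (X w) = q ^ card S" if "w \<in> I" for w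
  proof -
    have "X w = indicator {\<omega>. \<forall>e\<in>J w. \<omega> e = \<beta>}" by (auto simp: X_def fun_eq_iff)
    then have "measure_pmf.expectation P (X w) = measure_pmf.prob P {\<omega>. \<forall>e\<in>J w. \<omega> e = \<beta>}" by simp
    also have "{\<omega>. \<forall>e\<in>J w. \<omega> e = \<beta>} = Pi ([V]\<^bsup>2\<^esup>) (\<lambda>e. if e \<in> J w then {\<beta>} else UNIV)"
      using JE[OF that] by (force simp: Pi_def)
    also have "measure_pmf.prob P \<dots> = (\<Prod>e\<in>[V]\<^bsup>2\<^esup>. if e \<in> J w then q else 1)"
      unfolding P_def measure_Pi_pmf_Pi[OF finE]
      by (intro prod.cong refl) (auto simp: q_def measure_pmf_single)
    also have "\<dots> = (\<Prod>e\<in>J w. q)"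
      using JE[OF that] finE by (subst prod.If_cases) (auto simp: Int_absorb1)
    also have "card (J w) = card S"
      unfolding J_def by (rule card_image) (auto simp: inj_on_def doubleton_eq_iff)
    then have "(\<Prod>e\<in>J w. q) = q ^ card S" by simp
    finally show ?thesis .
  qed
  interpret H: Hoeffding_ineq "measure_pmf P" I X "\<lambda>_. 0" "\<lambda>_. 1" "\<Sum>w\<in>I. measure_pmf.expectation P (X w)"
    by unfold_locales (auto simp: fin indep X_def)
  have cI: "card I > 0" "card I \<le> m"
    using fin False W card_mono[of W I] V by (auto simp: I_def card_gt_0_iff finite_subset)
  have q: "0 \<le> q" by (simp add: q_def)
  have sumX: "(\<Sum>w\<in>I. X w \<omega>) = real (card {w \<in> W - S. \<forall>x\<in>S. \<omega> {x, w} = \<beta>})" for \<omega>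
    using fin by (simp add: X_def J_def sum.If_cases I_def Int_def)
  have "measure_pmf.prob P {\<omega>. q ^ card S * m + t \<le> (\<Sum>w\<in>I. X w \<omega>)}
      \<le> measure_pmf.prob P {\<omega> \<in> space (measure_pmf P). (\<Sum>w\<in>I. X w \<omega>) \<ge> (\<Sum>w\<in>I. measure_pmf.expectation P (X w)) + t}"
  proof (rule measure_pmf.finite_measure_mono)
    have "(\<Sum>w\<in>I. measure_pmf.expectation P (X w)) \<le> q ^ card S * m"
      using E cI q by (simp add: mult.commute[of "q ^ _"] mult_right_mono)
    then show "{\<omega>. q ^ card S * m + t \<le> (\<Sum>w\<in>I. X w \<omega>)} \<subseteq>
      {\<omega> \<in> space (measure_pmf P). (\<Sum>w\<in>I. X w \<omega>) \<ge> (\<Sum>w\<in>I. measure_pmf.expectation P (X w)) + t}"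
      by auto
  qed auto
  also have "\<dots> \<le> exp (-2 * t\<^sup>2 / (\<Sum>w\<in>I. (1 - 0)\<^sup>2))"
    by (rule H.Hoeffding_ineq_ge) (use t cI in auto)
  also have "\<dots> \<le> exp (- 2 * t\<^sup>2 / m)"
    using cI t by (simp add: field_simps mult_left_mono)
  finally show ?thesis by (simp add: P_def q_def sumX)
qed

text \<open>
  The union bound runs over tuples \<open>(u, v, i, \<beta>)\<close>, where \<open>u = v\<close> accounts for the singletons
  \<open>S\<close>; their number is the first factor in the hypothesis \<open>large\<close>.
\<close>
lemma quasirandom_graph_exists:
  fixes p \<eta> :: real and V :: "'a set" and part :: "nat \<Rightarrow> 'a set"
  assumes V: "finite V" "\<And>i. i < k \<Longrightarrow> part i \<subseteq> V" "\<And>i. i < k \<Longrightarrow> card (part i) \<le> m"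
    and p: "0 \<le> p" "p \<le> 1" and m: "m > 0" and \<eta>: "\<eta> > 0"
    and large: "2 * k * (card V)\<^sup>2 * exp (- 2 * \<eta>\<^sup>2 * m) < 1"
  obtains \<omega> :: "'a set \<Rightarrow> bool" where
    "\<And>S i \<beta>. S \<subseteq> V \<Longrightarrow> card S \<in> {1, 2} \<Longrightarrow> i < k \<Longrightarrow>
       real (card {w \<in> part i - S. \<forall>x\<in>S. \<omega> {x, w} = \<beta>})
         < ((if \<beta> then p else 1 - p) ^ card S + \<eta>) * m"
proof -
  define P where "P = Pi_pmf ([V]\<^bsup>2\<^esup>) False (\<lambda>_. bernoulli_pmf p)"
  define bad where "bad = (\<lambda>(u, v, i, \<beta>). {\<omega>. pmf (bernoulli_pmf p) \<beta> ^ card {u, v} * m + \<eta> * m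
     \<le> real (card {w \<in> part i - {u, v}. \<forall>x\<in>{u, v}. \<omega> {x, w} = \<beta>})})"
  define T where "T = V \<times> V \<times> {..<k} \<times> (UNIV :: bool set)"
  have finT: "finite T" using V by (simp add: T_def)
  have cT: "card T = 2 * k * (card V)\<^sup>2"
    by (simp add: T_def card_cartesian_product power2_eq_square)
  have "measure_pmf.prob P (\<Union>(bad ` T)) \<le> (\<Sum>\<tau>\<in>T. measure_pmf.prob P (bad \<tau>))"
    by (rule measure_pmf.finite_measure_subadditive_finite[OF finT]) auto
  also have "\<dots> \<le> (\<Sum>\<tau>\<in>T. exp (- 2 * \<eta>\<^sup>2 * m))"
  proof (rule sum_mono)
    fix \<tau> assume "\<tau> \<in> T"
    then obtain u v i \<beta> where \<tau>: "\<tau> = (u, v, i, \<beta>)" "u \<in> V" "v \<in> V" "i < k"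
      by (auto simp: T_def)
    have "measure_pmf.prob P (bad \<tau>) \<le> exp (- 2 * (\<eta> * m)\<^sup>2 / m)"
      using prob_common_neighbours_exceed[of V "{u, v}" "part i" p m "\<eta> * m" \<beta>] V p m \<eta> \<tau>
      by (simp add: P_def bad_def)
    also have "- 2 * (\<eta> * m)\<^sup>2 / m = - 2 * \<eta>\<^sup>2 * m"
      using m by (simp add: power2_eq_square)
    finally show "measure_pmf.prob P (bad \<tau>) \<le> exp (- 2 * \<eta>\<^sup>2 * m)" .
  qed
  also have "\<dots> < 1" using large by (simp add: cT)
  finally have "measure_pmf.prob P (\<Union>(bad ` T)) < 1" .
  then obtain \<omega> where \<omega>: "\<omega> \<notin> \<Union>(bad ` T)"
    by (metis UNIV_eq_I measure_pmf_UNIV less_irrefl)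
  show ?thesis
  proof (rule that)
    fix S i \<beta> assume S: "S \<subseteq> V" "card S \<in> {1, 2::nat}" "i < k"
    then obtain u v where uv: "S = {u, v}"
      by (auto simp: card_1_singleton_iff card_2_iff)
    then have "(u, v, i, \<beta>) \<in> T" using S by (auto simp: T_def)
    then have "\<omega> \<notin> bad (u, v, i, \<beta>)" using \<omega> by blast
    moreover have "pmf (bernoulli_pmf p) \<beta> = (if \<beta> then p else 1 - p)"
      using p by (cases \<beta>) auto
    ultimately show "real (card {w \<in> part i - S. \<forall>x\<in>S. \<omega> {x, w} = \<beta>})
         < ((if \<beta> then p else 1 - p) ^ card S + \<eta>) * m"
      unfolding bad_def uv by (simp add: algebra_simps not_le)
  qed
qed

section \<open>The lower bound\<close>

text \<open>
  The two hypotheses on \<open>b\<close> are the bounds for blue edges inside a part and between two parts.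
  A red edge always joins two parts, and all common red neighbours of its ends lie in the third.
\<close>
lemma three_part_colouring:
  fixes p \<eta> :: real and m a b :: nat
  assumes p: "0 \<le> p" "p \<le> 1" and m: "m > 0" and \<eta>: "\<eta> > 0"
    and large: "54 * (real m)\<^sup>2 * exp (- 2 * \<eta>\<^sup>2 * m) < 1"
    and red: "((1 - p)\<^sup>2 + \<eta>) * m \<le> a"
    and blue_inside: "m + 2 * ((p\<^sup>2 + \<eta>) * m) \<le> b"
    and blue_across: "2 * ((p + \<eta>) * m) + (p\<^sup>2 + \<eta>) * m \<le> b"
  shows "\<not> arrows (3 * m) (book a) (book b)"
proof -
  define part where "part i = {i * m..<Suc i * m}" for i
  have part_iff: "x \<in> part i \<longleftrightarrow> x div m = i" for x i
    using m by (auto simp: part_def div_nat_eqI dividend_less_times_div mult.commute)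
  have card_part: "card (part i) = m" and finite_part: "finite (part i)" for i
    by (simp_all add: part_def)
  have in_part: "x div m < 3" if "x < 3 * m" for x
    using that m by (simp add: less_mult_imp_div_less)
  have part_V: "part i \<subseteq> {..<3 * m}" if "i < 3" for i
  proof -
    have "Suc i * m \<le> 3 * m" using that by (intro mult_right_mono) auto
    then have "x < 3 * m" if "x < Suc i * m" for x using that by (rule order_less_le_trans[rotated])
    then show ?thesis by (auto simp: part_def)
  qed
  obtain \<omega> :: "nat set \<Rightarrow> bool" where
    \<omega>: "\<And>S i \<beta>. S \<subseteq> {..<3 * m} \<Longrightarrow> card S \<in> {1, 2} \<Longrightarrow> i < 3 \<Longrightarrow>
       real (card {w \<in> part i - S. \<forall>x\<in>S. \<omega> {x, w} = \<beta>})
         < ((if \<beta> then p else 1 - p) ^ card S + \<eta>) * m"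
    by (rule quasirandom_graph_exists[of "{..<3 * m}" 3 part m p \<eta>])
      (use part_V p m \<eta> large in \<open>auto simp: card_part power2_eq_square\<close>)
  define T where "T S i \<beta> = {w \<in> part i - S. \<forall>x\<in>S. \<omega> {x, w} = \<beta>}" for S i \<beta>
  have finT: "finite (T S i \<beta>)" for S i \<beta> by (simp add: T_def finite_part)
  have T2: "real (card (T {x, y} i \<beta>)) < ((if \<beta> then p else 1 - p)\<^sup>2 + \<eta>) * m"
    if "x < 3 * m" "y < 3 * m" "x \<noteq> y" "i < 3" for x y i \<beta>
    using \<omega>[of "{x, y}" i \<beta>] that by (cases \<beta>) (simp_all add: T_def power2_eq_square)
  have T1: "real (card (T {x} i True)) < (p + \<eta>) * m" if "x < 3 * m" "i < 3" for x i
    using \<omega>[of "{x}" i True] that by (simp add: T_def)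
  define c where "c e = (if (\<exists>i. e \<subseteq> part i) \<or> \<omega> e then Blue else Red)" for e
  have c_iff: "c {x, y} = Blue \<longleftrightarrow> x div m = y div m \<or> \<omega> {x, y}"
    "c {x, y} = Red \<longleftrightarrow> x div m \<noteq> y div m \<and> \<not> \<omega> {x, y}" for x y
    by (auto simp: c_def part_iff)
  have third: "\<exists>k<3. k \<noteq> i \<and> k \<noteq> j \<and> (\<forall>l<3. l = i \<or> l = j \<or> l = k)"
    if "i < 3" "j < 3" "i \<noteq> j" for i j :: nat
    by (rule exI[of _ "3 - i - j"]) (use that in presburger)
  show ?thesis
  proof (rule not_arrows_booksI[of _ c])
    fix x y assume xy: "x < 3 * m" "y < 3 * m" "x \<noteq> y" and "c {x, y} = Red"
    then have diff: "x div m \<noteq> y div m" by (simp add: c_iff)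
    then obtain k where k: "k < 3" "\<forall>l<3. l = x div m \<or> l = y div m \<or> l = k"
      using third in_part xy by blast
    let ?Z = "{z. z < 3 * m \<and> z \<noteq> x \<and> z \<noteq> y \<and> c {x, z} = Red \<and> c {y, z} = Red}"
    have "?Z \<subseteq> T {x, y} k False"
      using in_part k(2) by (force simp: T_def part_iff c_iff)
    then have "card ?Z \<le> card (T {x, y} k False)" by (intro card_mono finT)
    then have "real (card ?Z) < a" using T2[OF xy k(1), of False] red by simp
    then show "card ?Z < a" by simp
  next
    fix x y assume xy: "x < 3 * m" "y < 3 * m" "x \<noteq> y" and "c {x, y} = Blue"
    let ?Z = "{z. z < 3 * m \<and> z \<noteq> x \<and> z \<noteq> y \<and> c {x, z} = Blue \<and> c {y, z} = Blue}"
    have "real (card ?Z) < b"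
    proof (cases "x div m = y div m")
      case True
      obtain j k where jk: "j < 3" "k < 3" "\<forall>l<3. l = x div m \<or> l = j \<or> l = k"
      proof -
        obtain j :: nat where "j < 3" "j \<noteq> x div m"
          by (cases "x div m = 0") (auto intro: that[of 0] that[of 1])
        then show ?thesis using third[of "x div m" j] in_part[OF xy(1)] that by metis
      qed
      have "?Z \<subseteq> part (x div m) \<union> T {x, y} j True \<union> T {x, y} k True"
        using in_part jk(3) True by (force simp: T_def part_iff c_iff)
      then have "card ?Z \<le> card (part (x div m) \<union> T {x, y} j True \<union> T {x, y} k True)"
        by (intro card_mono) (auto simp: finT finite_part)
      also have "\<dots> \<le> m + card (T {x, y} j True) + card (T {x, y} k True)"
        using card_Un_le[of "part (x div m) \<union> T {x, y} j True" "T {x, y} k True"]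
          card_Un_le[of "part (x div m)" "T {x, y} j True"] card_part[of "x div m"] by linarith
      finally show ?thesis
        using T2[OF xy jk(1), of True] T2[OF xy jk(2), of True] blue_inside by simp
    next
      case False
      then obtain k where k: "k < 3" "\<forall>l<3. l = x div m \<or> l = y div m \<or> l = k"
        using third in_part xy by blast
      have "?Z \<subseteq> T {y} (x div m) True \<union> T {x} (y div m) True \<union> T {x, y} k True"
        using in_part k(2) False by (force simp: T_def part_iff c_iff)
      then have "card ?Z \<le> card (T {y} (x div m) True \<union> T {x} (y div m) True \<union> T {x, y} k True)"
        by (intro card_mono) (auto simp: finT)
      also have "\<dots> \<le> card (T {y} (x div m) True) + card (T {x} (y div m) True) + card (T {x, y} k True)"
        using card_Un_le[of "T {y} (x div m) True \<union> T {x} (y div m) True" "T {x, y} k True"]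
          card_Un_le[of "T {y} (x div m) True" "T {x} (y div m) True"] by linarith
      finally show ?thesis
        using T2[OF xy k(1), of True] T1[OF xy(2) in_part[OF xy(1)]]
          T1[OF xy(1) in_part[OF xy(2)]] blue_across by simp
    qed
    then show "card ?Z < b" by simp
  qed
qed

lemma eventually_union_bound_small:
  fixes c :: real
  assumes "c > 0"
  shows "\<forall>\<^sub>F m::nat in sequentially. 54 * (real m)\<^sup>2 * exp (- c * m) < 1"
proof -
  have "((\<lambda>m::nat. 54 * (real m)\<^sup>2 * exp (- c * real m)) \<longlonglongrightarrow> 0)"
    using assms by real_asymp
  then show ?thesis by (rule order_tendstoD) simp
qed

text \<open>
  The part size \<open>m\<close> is \<open>n/(1 + 2p\<^sup>2)\<close> reduced by the factor \<open>1 - \<delta>\<close>, which leaves room for the random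
  deviation \<open>\<eta>m\<close>: an edge inside a part needs \<open>2\<eta> \<le> \<delta>\<close>, a blue edge between two parts \<open>3\<eta> \<le> \<delta>\<close>, and a
  red edge \<open>\<eta> \<le> \<delta>\<alpha>\<close>.
\<close>
lemma ramsey_books_lower_bound:
  fixes \<alpha> p \<epsilon> :: real
  assumes p: "0 \<le> p" "p \<le> 1" and \<alpha>: "\<alpha> > 0"
    and eq: "(1 - p)\<^sup>2 = \<alpha> * (1 + 2 * p\<^sup>2)" and \<epsilon>: "\<epsilon> > 0"
  shows "\<forall>\<^sub>F n in sequentially. (3 / (1 + 2 * p\<^sup>2) - \<epsilon>) * real n
           \<le> real (ramsey_number (book (nat \<lceil>\<alpha> * real n\<rceil>)) (book n))"
proof -
  define D where "D = 1 + 2 * p\<^sup>2"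
  define \<delta> where "\<delta> = min (\<epsilon> / 6) (1 / 2)"
  define \<eta> where "\<eta> = \<delta> * min \<alpha> (1 / 3)"
  define m where "m n = nat \<lfloor>(1 - \<delta>) * real n / D\<rfloor>" for n
  have D: "D \<ge> 1" by (simp add: D_def)
  have \<delta>: "0 < \<delta>" "\<delta> \<le> \<epsilon> / 6" "\<delta> < 1" using \<epsilon> by (auto simp: \<delta>_def)
  have \<eta>: "0 < \<eta>" "\<eta> \<le> \<delta> * \<alpha>" "3 * \<eta> \<le> \<delta>"
    using \<delta>(1) \<alpha> mult_left_mono[of "min \<alpha> (1/3)" "1/3" \<delta>] by (auto simp: \<eta>_def)
  have "filterlim m at_top sequentially"
    unfolding m_def using \<delta> D by real_asymp
  then have ev: "\<forall>\<^sub>F n in sequentially. 54 * (real (m n))\<^sup>2 * exp (- (2 * \<eta>\<^sup>2) * m n) < 1"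
    "\<forall>\<^sub>F n in sequentially. m n > 0"
    using eventually_compose_filterlim[OF eventually_union_bound_small[of "2 * \<eta>\<^sup>2"]] \<eta>(1)
      eventually_compose_filterlim[OF eventually_gt_at_top] by auto
  have "\<forall>\<^sub>F n in sequentially. real n \<ge> 6 / \<epsilon>"
    by real_asymp
  with ev show ?thesis
  proof eventually_elim
    case (elim n)
    let ?x = "(1 - \<delta>) * real n / D"
    have x0: "0 \<le> ?x" using \<delta> D by simp
    then have mx: "real (m n) \<le> ?x" "?x < real (m n) + 1"
      unfolding m_def by linarith+
    have mD: "real (m n) * D \<le> (1 - \<delta>) * real n"
      using mx(1) D by (simp add: field_simps)
    have mn: "real (m n) \<le> real n"
    proof -
      have "real (m n) * 1 \<le> real (m n) * D" using D by (intro mult_left_mono) auto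
      also have "\<dots> \<le> 1 * real n" using mD \<delta> by (intro order_trans[OF mD] mult_right_mono) auto
      finally show ?thesis by simp
    qed
    have \<eta>mn: "\<eta> * m n \<le> \<eta> * n" using mn \<eta>(1) by (intro mult_left_mono) auto
    have "\<not> arrows (3 * m n) (book (nat \<lceil>\<alpha> * real n\<rceil>)) (book n)"
    proof (rule three_part_colouring[OF p])
      show "54 * (real (m n))\<^sup>2 * exp (- 2 * \<eta>\<^sup>2 * real (m n)) < 1" using elim by simp
      have "((1 - p)\<^sup>2 + \<eta>) * m n = \<alpha> * (m n * D) + \<eta> * m n"
        unfolding eq D_def by (simp add: algebra_simps)
      also have "\<dots> \<le> \<alpha> * ((1 - \<delta>) * n) + \<delta> * \<alpha> * n"
        using \<alpha> mD \<eta>mn \<eta>(2) mult_right_mono[OF \<eta>(2), of "real n"]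
        by (intro add_mono mult_left_mono) auto
      also have "\<dots> = \<alpha> * n" by (simp add: algebra_simps)
      also have "\<dots> \<le> real (nat \<lceil>\<alpha> * real n\<rceil>)" by linarith
      finally show "((1 - p)\<^sup>2 + \<eta>) * m n \<le> real (nat \<lceil>\<alpha> * real n\<rceil>)" .
      have 3: "3 * (\<eta> * m n) \<le> \<delta> * n"
        using \<eta>mn mult_right_mono[OF \<eta>(3), of "real n"] by simp
      have "m n * D + 3 * (\<eta> * m n) \<le> n" using mD 3 by (simp add: algebra_simps)
      moreover have "0 \<le> \<eta> * m n" using \<eta> by simp
      moreover have "m n * D = m n + 2 * (p\<^sup>2 * m n)" by (simp add: D_def algebra_simps)
      ultimately show "m n + 2 * ((p\<^sup>2 + \<eta>) * m n) \<le> n"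
        by (simp add: algebra_simps)
      have "0 \<le> (1 - p)\<^sup>2 * m n" by simp
      then have "2 * (p * m n) \<le> m n + p\<^sup>2 * m n"
        by (simp add: power2_eq_square algebra_simps)
      then show "2 * ((p + \<eta>) * m n) + (p\<^sup>2 + \<eta>) * m n \<le> n"
        using \<open>m n * D + 3 * (\<eta> * m n) \<le> n\<close> \<open>m n * D = _\<close> by (simp add: algebra_simps)
    qed (use elim \<eta> in auto)
    then have "3 * m n < ramsey_number (book (nat \<lceil>\<alpha> * real n\<rceil>)) (book n)"
      by (intro less_ramsey_number fin_simple_graph_book)
    moreover have "(3 / D - \<epsilon>) * n \<le> 3 * m n"
    proof -
      have "6 \<le> \<epsilon> * n" using elim(3) \<epsilon> by (simp add: field_simps)
      have "(3 / D) * (\<delta> * n) \<le> 3 * (\<delta> * n)"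
        using D \<delta> by (intro mult_right_mono) (auto simp: field_simps)
      also have "\<dots> \<le> \<epsilon> * n / 2" using mult_right_mono[OF \<delta>(2), of "real n"] by simp
      finally have "(3 / D) * (\<delta> * n) \<le> \<epsilon> * n - 3" using \<open>6 \<le> \<epsilon> * n\<close> by simp
      moreover have "3 * ?x = (3 / D) * n - (3 / D) * (\<delta> * n)"
        by (simp add: algebra_simps diff_divide_distrib)
      moreover have "(3 / D - \<epsilon>) * n = (3 / D) * n - \<epsilon> * n" by (rule left_diff_distrib)
      ultimately show ?thesis using mx(2) by linarith
    qed
    ultimately show ?case unfolding D_def[symmetric] by linarith
  qed
qed

section \<open>Adjacency densities, fibres and homogeneous sets\<close>

definition adj_density :: "('a \<Rightarrow> 'b \<Rightarrow> bool) \<Rightarrow> 'a set \<Rightarrow> 'b \<Rightarrow> real" where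
  "adj_density c Q z = real (card {q \<in> Q. c q z}) / real (card Q)"

lemma adj_density_bounds: "finite Q \<Longrightarrow> 0 \<le> adj_density c Q z" "finite Q \<Longrightarrow> adj_density c Q z \<le> 1"
  by (auto simp: adj_density_def divide_le_eq_1 card_mono)

lemma adj_density_not:
  assumes "finite Q" "Q \<noteq> {}"
  shows "adj_density (\<lambda>x z. \<not> c x z) Q z = 1 - adj_density c Q z"
proof -
  have "card Q = card {q \<in> Q. c q z} + card {q \<in> Q. \<not> c q z}"
    using assms by (subst card_Un_disjoint[symmetric]) (auto intro!: arg_cong[of _ _ card])
  then have "real (card {q \<in> Q. \<not> c q z}) = real (card Q) - real (card {q \<in> Q. c q z})" by linarith
  then show ?thesis
    using assms by (simp add: adj_density_def diff_divide_distrib)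
qed

lemma sum_adj_density:
  assumes "finite W" "finite Q"
  shows "(\<Sum>z\<in>W. adj_density c Q z) = (\<Sum>x\<in>Q. real (card {z \<in> W. c x z})) / real (card Q)"
proof -
  have "(\<Sum>z\<in>W. real (card {q \<in> Q. c q z})) = (\<Sum>z\<in>W. \<Sum>x\<in>Q. of_bool (c x z))"
    using assms by (simp add: of_bool_def sum.If_cases Int_def)
  also have "\<dots> = (\<Sum>x\<in>Q. \<Sum>z\<in>W. of_bool (c x z))" by (rule sum.swap)
  also have "\<dots> = (\<Sum>x\<in>Q. real (card {z \<in> W. c x z}))"
    using assms by (simp add: of_bool_def sum.If_cases Int_def)
  finally show ?thesis by (simp add: adj_density_def sum_divide_distrib[symmetric])
qed

lemma sum_adj_density_mult:
  assumes "finite W" "finite Q" "finite Q'"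
  shows "(\<Sum>z\<in>W. adj_density c Q z * adj_density c Q' z)
       = (\<Sum>x\<in>Q. \<Sum>y\<in>Q'. real (card {z \<in> W. c x z \<and> c y z})) / (real (card Q) * real (card Q'))"
proof -
  have "(\<Sum>z\<in>W. real (card {q \<in> Q. c q z}) * real (card {q \<in> Q'. c q z}))
      = (\<Sum>z\<in>W. (\<Sum>x\<in>Q. of_bool (c x z)) * (\<Sum>y\<in>Q'. of_bool (c y z)))"
    using assms by (simp add: of_bool_def sum.If_cases Int_def)
  also have "\<dots> = (\<Sum>z\<in>W. \<Sum>x\<in>Q. \<Sum>y\<in>Q'. of_bool (c x z \<and> c y z))"
    by (simp add: sum_product of_bool_conj)
  also have "\<dots> = (\<Sum>x\<in>Q. \<Sum>z\<in>W. \<Sum>y\<in>Q'. of_bool (c x z \<and> c y z))" by (rule sum.swap)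
  also have "\<dots> = (\<Sum>x\<in>Q. \<Sum>y\<in>Q'. \<Sum>z\<in>W. of_bool (c x z \<and> c y z))"
    by (intro sum.cong refl sum.swap)
  also have "\<dots> = (\<Sum>x\<in>Q. \<Sum>y\<in>Q'. real (card {z \<in> W. c x z \<and> c y z}))"
    using assms by (simp add: of_bool_def sum.If_cases Int_def)
  finally show ?thesis by (simp add: adj_density_def sum_divide_distrib[symmetric])
qed

lemma sum_adj_density_mult_le:
  assumes fin: "finite W" "finite Q" "finite Q'" and ne: "Q \<noteq> {}" "Q' \<noteq> {}"
    and B: "\<And>x y. x \<in> Q \<Longrightarrow> y \<in> Q' \<Longrightarrow> real (card {z \<in> W. c x z \<and> c y z}) \<le> B"
  shows "(\<Sum>z\<in>W. adj_density c Q z * adj_density c Q' z) \<le> B"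
proof -
  have "(\<Sum>x\<in>Q. \<Sum>y\<in>Q'. real (card {z \<in> W. c x z \<and> c y z})) \<le> (\<Sum>x\<in>Q. \<Sum>y\<in>Q'. B)"
    by (intro sum_mono B)
  also have "\<dots> = B * (real (card Q) * real (card Q'))" by simp
  finally show ?thesis
    using fin ne by (simp add: sum_adj_density_mult divide_le_eq card_gt_0_iff zero_less_mult_iff)
qed

text \<open>
  The diagonal pairs, on which the hypothesis says nothing, contribute at most \<open>|W|/|Q|\<close> in all; this
  is why only large cliques are of use below.
\<close>
lemma sum_adj_density_power2_le:
  assumes fin: "finite W" "finite Q" and ne: "Q \<noteq> {}" and B0: "B \<ge> 0"
    and B: "\<And>x y. x \<in> Q \<Longrightarrow> y \<in> Q \<Longrightarrow> x \<noteq> y \<Longrightarrow> real (card {z \<in> W. c x z \<and> c y z}) \<le> B"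
  shows "(\<Sum>z\<in>W. (adj_density c Q z)\<^sup>2) \<le> B + card W / card Q"
proof -
  have "(\<Sum>x\<in>Q. \<Sum>y\<in>Q. real (card {z \<in> W. c x z \<and> c y z}))
      \<le> (\<Sum>x\<in>Q. \<Sum>y\<in>Q. B + (if y = x then real (card W) else 0))"
  proof (intro sum_mono)
    fix x y assume "x \<in> Q" "y \<in> Q"
    moreover have "card {z \<in> W. c x z \<and> c y z} \<le> card W" using fin by (intro card_mono) auto
    ultimately show "real (card {z \<in> W. c x z \<and> c y z}) \<le> B + (if y = x then real (card W) else 0)"
      using B[of x y] B0 by auto
  qed
  also have "\<dots> = (B + card W / card Q) * (real (card Q) * real (card Q))"
    using fin ne by (simp add: sum.distrib sum.delta field_simps)
  finally show ?thesis
    using fin ne by (simp add: power2_eq_square sum_adj_density_mult divide_le_eq card_gt_0_iff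
        zero_less_mult_iff)
qed

lemma card_le_fibres:
  assumes "finite T" "t ` U \<subseteq> T" "finite U" "\<And>a. a \<in> T \<Longrightarrow> card {u \<in> U. t u = a} \<le> R"
  shows "card U \<le> card T * R"
proof -
  have "U = (\<Union>a\<in>T. {u \<in> U. t u = a})" using assms by auto
  then have "card U \<le> (\<Sum>a\<in>T. card {u \<in> U. t u = a})"
    using card_UN_le[OF assms(1), of "\<lambda>a. {u \<in> U. t u = a}"] by simp
  also have "\<dots> \<le> (\<Sum>a\<in>T. R)" by (intro sum_mono assms)
  finally show ?thesis by simp
qed

lemma subset_with_smallest_values:
  fixes s :: "'a \<Rightarrow> 'b::linorder"
  assumes "finite A" "n \<le> card A"
  obtains B where "B \<subseteq> A" "card B = n" "\<And>x y. x \<in> B \<Longrightarrow> y \<in> A - B \<Longrightarrow> s x \<le> s y"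
proof -
  have "\<exists>B\<subseteq>A. card B = n \<and> (\<forall>x\<in>B. \<forall>y\<in>A - B. s x \<le> s y)"
    using assms(2)
  proof (induction n)
    case 0 then show ?case by (intro exI[of _ "{}"]) auto
  next
    case (Suc n)
    then obtain B where B: "B \<subseteq> A" "card B = n" "\<forall>x\<in>B. \<forall>y\<in>A - B. s x \<le> s y" by auto
    then have "A - B \<noteq> {}" using Suc.prems by auto
    then obtain b where b: "b \<in> A - B" "\<And>y. y \<in> A - B \<Longrightarrow> s b \<le> s y"
      using ex_is_arg_min_if_finite[of "A - B" s] assms(1)
      by (auto simp: is_arg_min_linorder)
    show ?case
      by (rule exI[of _ "insert b B"])
        (use B b assms(1) in \<open>auto simp: finite_subset card_insert_if\<close>)
  qed
  then show ?thesis using that by blast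
qed

text \<open>
  The \<open>n\<close> largest values have at least the average of all values.
\<close>
lemma subset_with_large_average:
  fixes d :: "'a \<Rightarrow> real" and t :: real
  assumes A: "finite A" "n \<le> card A" and avg: "(\<Sum>x\<in>A. d x) \<ge> card A * t"
  obtains B where "B \<subseteq> A" "card B = n" "(\<Sum>x\<in>B. d x) \<ge> n * t"
proof (cases "n = 0")
  case True then show ?thesis using that[of "{}"] by simp
next
  case False
  obtain B where B: "B \<subseteq> A" "card B = n" "\<And>x y. x \<in> B \<Longrightarrow> y \<in> A - B \<Longrightarrow> - d x \<le> - d y"
    using subset_with_smallest_values[OF A, of "\<lambda>x. - d x"] by blast
  have finB: "finite B" and neB: "B \<noteq> {}" using B False A finite_subset by auto
  define m where "m = Min (d ` B)"
  have mB: "m \<le> d x" if "x \<in> B" for x using that finB by (simp add: m_def)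
  have mA: "d y \<le> m" if "y \<in> A - B" for y
    using B(3) that Min_in[of "d ` B"] finB neB by (force simp: m_def)
  have "n * t \<le> (\<Sum>x\<in>B. d x)"
  proof (cases "t \<le> m")
    case True
    have "n * t \<le> (\<Sum>x\<in>B. m)" using B(2) True by (simp add: mult_left_mono)
    also have "\<dots> \<le> (\<Sum>x\<in>B. d x)" by (intro sum_mono mB)
    finally show ?thesis .
  next
    case False
    have "(\<Sum>x\<in>A. d x) = (\<Sum>x\<in>B. d x) + (\<Sum>x\<in>A - B. d x)"
      using B(1) A(1) by (simp add: sum.subset_diff add.commute)
    moreover have "(\<Sum>x\<in>A - B. d x) \<le> (\<Sum>x\<in>A - B. t)"
      by (intro sum_mono) (use mA False in fastforce)
    moreover have "(\<Sum>x\<in>A - B. t) = card A * t - n * t"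
      using B A finB by (simp add: card_Diff_subset of_nat_diff card_mono algebra_simps)
    ultimately show ?thesis using avg by linarith
  qed
  then show ?thesis using that B by blast
qed

lemma maximal_disjoint_family:
  assumes "finite V"
  shows "\<exists>\<C>. disjoint \<C> \<and> (\<forall>P\<in>\<C>. P \<subseteq> V \<and> P \<noteq> {} \<and> good P) \<and>
           (\<forall>P \<subseteq> V - \<Union>\<C>. P \<noteq> {} \<longrightarrow> \<not> good P)"
  using assms
proof (induction V rule: finite_psubset_induct)
  case (psubset V)
  show ?case
  proof (cases "\<exists>P\<subseteq>V. P \<noteq> {} \<and> good P")
    case False
    then show ?thesis by (intro exI[of _ "{}"]) auto
  next
    case True
    then obtain P where P: "P \<subseteq> V" "P \<noteq> {}" "good P" by blast
    then have "V - P \<subset> V" by blast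
    then obtain \<C> where \<C>: "disjoint \<C>" "\<forall>P'\<in>\<C>. P' \<subseteq> V - P \<and> P' \<noteq> {} \<and> good P'"
      "\<forall>P' \<subseteq> V - P - \<Union>\<C>. P' \<noteq> {} \<longrightarrow> \<not> good P'"
      using psubset.IH by meson
    have "disjoint (insert P \<C>)"
      using \<C>(1,2) by (fastforce simp: disjoint_def)
    moreover have "V - \<Union>(insert P \<C>) = V - P - \<Union>\<C>" by auto
    ultimately show ?thesis
      using P \<C> by (intro exI[of _ "insert P \<C>"]) (auto 0 3)
  qed
qed

definition homogeneous :: "('a \<Rightarrow> 'a \<Rightarrow> bool) \<Rightarrow> 'a set \<Rightarrow> bool" where
  "homogeneous c Q \<longleftrightarrow> (\<forall>x\<in>Q. \<forall>y\<in>Q. x \<noteq> y \<longrightarrow> c x y)"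

lemma homogeneous_subset: "homogeneous c Q \<Longrightarrow> Q' \<subseteq> Q \<Longrightarrow> homogeneous c Q'"
  by (auto simp: homogeneous_def)

definition ramsey_bound :: "nat \<Rightarrow> nat \<Rightarrow> nat \<Rightarrow> bool" where
  "ramsey_bound k l R \<longleftrightarrow> (\<forall>(U :: nat set) c. finite U \<and> symp c \<and> R \<le> card U \<longrightarrow>
     (\<exists>Q\<subseteq>U. card Q = k \<and> homogeneous c Q) \<or>
     (\<exists>Q\<subseteq>U. card Q = l \<and> homogeneous (\<lambda>x y. \<not> c x y) Q))"

lemma ramsey_bound_exists: "\<exists>R\<ge>1. ramsey_bound k l R"
proof -
  obtain R :: nat where "R \<ge> 1" and R: "\<forall>(V::nat set) E. finite V \<and> card V \<ge> R \<longrightarrow>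
    (\<exists>Q \<subseteq> V. card Q = k \<and> clique Q E \<or> card Q = l \<and> indep Q E)"
    using ramsey2 by metis
  have "(\<exists>Q\<subseteq>U. card Q = k \<and> homogeneous c Q) \<or>
        (\<exists>Q\<subseteq>U. card Q = l \<and> homogeneous (\<lambda>x y. \<not> c x y) Q)"
    if U: "finite U" "R \<le> card U" and c: "symp c" for U :: "nat set" and c
  proof -
    define E where "E = {{x, y} | x y. c x y}"
    have E: "{x, y} \<in> E \<longleftrightarrow> c x y" for x y
      using c by (auto simp: E_def doubleton_eq_iff dest: sympD)
    obtain Q where "Q \<subseteq> U" "card Q = k \<and> clique Q E \<or> card Q = l \<and> indep Q E"
      using R U by blast
    then show ?thesis
      unfolding clique_def indep_def homogeneous_def E by blast
  qed
  then have "ramsey_bound k l R" unfolding ramsey_bound_def by simp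
  with \<open>R \<ge> 1\<close> show ?thesis by blast
qed

section \<open>Cliques in colourings with small books\<close>

text \<open>
  The assumptions say that the colouring, with \<open>r\<close> as its red graph, contains no red book with more
  than \<open>(1/12 - \<delta>)N\<close> triangles and no blue one with more than \<open>(1/2 - \<delta>)N\<close>. Blue is the negation of \<open>r\<close>, also on the
  diagonal, so that the two proportions at a vertex add up to one; this changes blue codegrees by at
  most two. The number \<open>L\<close> is a clique size beyond which diagonal terms cost at most \<open>\<delta>N/2\<close>.
\<close>
locale small_books =
  fixes V :: "nat set" and r :: "nat \<Rightarrow> nat \<Rightarrow> bool" and \<delta> :: real and L :: nat
  assumes finV: "finite V" and sym: "symp r"
    and red_codegree: "x \<in> V \<Longrightarrow> y \<in> V \<Longrightarrow> r x y \<Longrightarrow>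
      real (card {z \<in> V. r x z \<and> r y z}) \<le> (1 / 12 - \<delta>) * card V"
    and blue_codegree: "x \<in> V \<Longrightarrow> y \<in> V \<Longrightarrow> x \<noteq> y \<Longrightarrow> \<not> r x y \<Longrightarrow>
      real (card {z \<in> V. \<not> r x z \<and> \<not> r y z}) \<le> (1 / 2 - \<delta>) * card V"
    and \<delta>: "0 < \<delta>" "\<delta> \<le> 1 / 12" and L: "2 \<le> \<delta> * L" and V_ne: "V \<noteq> {}"
begin

abbreviation N :: real where "N \<equiv> real (card V)"
abbreviation f :: "nat set \<Rightarrow> nat \<Rightarrow> real" where "f \<equiv> adj_density r"
abbreviation red_clique :: "nat set \<Rightarrow> bool" where "red_clique \<equiv> homogeneous r"
abbreviation blue_clique :: "nat set \<Rightarrow> bool" where "blue_clique \<equiv> homogeneous (\<lambda>x y. \<not> r x y)"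

lemma N_pos: "N > 0" using finV V_ne by (simp add: card_gt_0_iff)

lemma L_pos: "L > 0" using L by (cases L) auto

lemma red_commute: "r x y \<longleftrightarrow> r y x" using sym by (auto dest: sympD)

lemma finQ: "Q \<subseteq> V \<Longrightarrow> finite Q" using finV finite_subset by blast

lemma one_minus_f: "Q \<subseteq> V \<Longrightarrow> L \<le> card Q \<Longrightarrow> 1 - f Q z = adj_density (\<lambda>x y. \<not> r x y) Q z"
  by (subst adj_density_not) (use L_pos finQ in auto)

lemma inverse_card_le:
  assumes "L \<le> card Q" shows "N / card Q \<le> \<delta> / 2 * N"
proof -
  have "2 \<le> \<delta> * card Q"
    using L assms \<delta>(1) by (meson less_imp_le mult_left_mono of_nat_mono order_trans)
  then have "1 / card Q \<le> \<delta> / 2" using assms L_pos by (simp add: field_simps)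
  from mult_right_mono[OF this, of N] show ?thesis by simp
qed

lemma blue_clique_sum:
  assumes Q: "Q \<subseteq> V" "L \<le> card Q" "blue_clique Q"
  shows "(\<Sum>z\<in>V. (1 - f Q z)\<^sup>2) \<le> (1 / 2 - \<delta> / 2) * N"
proof -
  have "(\<Sum>z\<in>V. (adj_density (\<lambda>x y. \<not> r x y) Q z)\<^sup>2) \<le> (1 / 2 - \<delta>) * N + N / card Q"
    by (rule sum_adj_density_power2_le)
      (use Q finV finQ L_pos \<delta> blue_codegree in \<open>auto simp: homogeneous_def subset_iff\<close>)
  also have "\<dots> \<le> (1 / 2 - \<delta> / 2) * N"
    using inverse_card_le[OF Q(2)] unfolding left_diff_distrib by linarith
  finally show ?thesis by (simp add: one_minus_f[OF Q(1,2)])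
qed

lemma red_clique_sum:
  assumes Q: "Q \<subseteq> V" "L \<le> card Q" "red_clique Q"
  shows "(\<Sum>z\<in>V. (f Q z)\<^sup>2) \<le> (1 / 12 - \<delta> / 2) * N"
proof -
  have "(\<Sum>z\<in>V. (f Q z)\<^sup>2) \<le> (1 / 12 - \<delta>) * N + N / card Q"
    by (rule sum_adj_density_power2_le)
      (use Q finV finQ L_pos \<delta> red_codegree in \<open>auto simp: homogeneous_def subset_iff\<close>)
  also have "\<dots> \<le> (1 / 12 - \<delta> / 2) * N"
    using inverse_card_le[OF Q(2)] unfolding left_diff_distrib by linarith
  finally show ?thesis .
qed

lemma red_pair_sum:
  assumes Q: "Q \<subseteq> V" "L \<le> card Q" and Q': "Q' \<subseteq> V" "L \<le> card Q'"
    and red: "\<forall>x\<in>Q. \<forall>y\<in>Q'. r x y"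
  shows "(\<Sum>z\<in>V. f Q z * f Q' z) \<le> (1 / 12 - \<delta>) * N"
  by (rule sum_adj_density_mult_le)
    (use assms finV finQ L_pos red_codegree in \<open>auto simp: subset_iff\<close>)

lemma blue_pair_sum:
  assumes Q: "Q \<subseteq> V" "L \<le> card Q" and Q': "Q' \<subseteq> V" "L \<le> card Q'"
    and blue: "\<forall>x\<in>Q. \<forall>y\<in>Q'. x \<noteq> y \<and> \<not> r x y"
  shows "(\<Sum>z\<in>V. (1 - f Q z) * (1 - f Q' z)) \<le> (1 / 2 - \<delta>) * N"
  unfolding one_minus_f[OF Q] one_minus_f[OF Q']
  by (rule sum_adj_density_mult_le)
    (use assms finV finQ L_pos blue_codegree in \<open>auto simp: subset_iff\<close>)

text \<open>
  Here \<open>(f\<^sub>1 + f\<^sub>2 + f\<^sub>3 - 1)\<^sup>2\<close> is the sum of the \<open>(1 - f\<^sub>i)\<^sup>2\<close> and of the \<open>2f\<^sub>if\<^sub>j\<close>, minus \<open>2\<close>. With the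
  averaged bounds this sums to at most \<open>(3/2 + 1/2 - 2)N\<close> minus a positive multiple of \<open>\<delta>N\<close>. Equality
  at \<open>\<delta> = 0\<close> corresponds to three blue parts with random edges between them.
\<close>
lemma no_three_blue_cliques:
  assumes Q: "Q1 \<subseteq> V" "L \<le> card Q1" "blue_clique Q1" "Q2 \<subseteq> V" "L \<le> card Q2" "blue_clique Q2"
      "Q3 \<subseteq> V" "L \<le> card Q3" "blue_clique Q3"
    and red: "\<forall>x\<in>Q1. \<forall>y\<in>Q2. r x y" "\<forall>x\<in>Q1. \<forall>y\<in>Q3. r x y" "\<forall>x\<in>Q2. \<forall>y\<in>Q3. r x y"
  shows False
proof -
  have "(\<Sum>z\<in>V. (f Q1 z + f Q2 z + f Q3 z - 1)\<^sup>2)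
     = (\<Sum>z\<in>V. ((1 - f Q1 z)\<^sup>2 + (1 - f Q2 z)\<^sup>2 + (1 - f Q3 z)\<^sup>2)
         + 2 * (f Q1 z * f Q2 z + f Q1 z * f Q3 z + f Q2 z * f Q3 z) - 2)"
    by (intro sum.cong refl) (simp add: power2_eq_square algebra_simps)
  also have "\<dots> = (\<Sum>z\<in>V. (1 - f Q1 z)\<^sup>2) + (\<Sum>z\<in>V. (1 - f Q2 z)\<^sup>2) + (\<Sum>z\<in>V. (1 - f Q3 z)\<^sup>2)
     + 2 * ((\<Sum>z\<in>V. f Q1 z * f Q2 z) + (\<Sum>z\<in>V. f Q1 z * f Q3 z) + (\<Sum>z\<in>V. f Q2 z * f Q3 z)) - 2 * N"
    by (simp add: sum.distrib sum_subtractf sum_distrib_left[symmetric])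
  also have "\<dots> \<le> 3 * ((1 / 2 - \<delta> / 2) * N) + 2 * (3 * ((1 / 12 - \<delta>) * N)) - 2 * N"
  proof -
    have "(\<Sum>z\<in>V. (1 - f Q1 z)\<^sup>2) + (\<Sum>z\<in>V. (1 - f Q2 z)\<^sup>2) + (\<Sum>z\<in>V. (1 - f Q3 z)\<^sup>2)
        \<le> 3 * ((1 / 2 - \<delta> / 2) * N)"
      using blue_clique_sum[OF Q(1-3)] blue_clique_sum[OF Q(4-6)] blue_clique_sum[OF Q(7-9)]
      by linarith
    moreover have "(\<Sum>z\<in>V. f Q1 z * f Q2 z) + (\<Sum>z\<in>V. f Q1 z * f Q3 z) + (\<Sum>z\<in>V. f Q2 z * f Q3 z)
        \<le> 3 * ((1 / 12 - \<delta>) * N)"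
      using red_pair_sum[OF Q(1,2,4,5) red(1)] red_pair_sum[OF Q(1,2,7,8) red(2)]
        red_pair_sum[OF Q(4,5,7,8) red(3)] by linarith
    ultimately show ?thesis by (intro diff_right_mono add_mono mult_left_mono) simp_all
  qed
  also have "\<dots> = - (15 / 2) * (\<delta> * N)" by (simp add: algebra_simps)
  also have "\<dots> < 0" using \<delta>(1) N_pos by simp
  finally have "(\<Sum>z\<in>V. (f Q1 z + f Q2 z + f Q3 z - 1)\<^sup>2) < 0" .
  moreover have "0 \<le> (\<Sum>z\<in>V. (f Q1 z + f Q2 z + f Q3 z - 1)\<^sup>2)" by (intro sum_nonneg) simp
  ultimately show False by linarith
qed

text \<open>
  A red clique has mean density at most \<open>1/\<surd>12 < 0.289\<close>, so \<open>S\<close>, the sum of \<open>f + f'\<close>, is at most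
  \<open>0.578N\<close>. On the other hand the Cauchy--Schwarz inequality and the bound for a blue pair give
  \<open>(N - S)\<^sup>2 \<le> N\<^sup>2/6\<close>, that is, \<open>S \<ge> 0.591N\<close>.
\<close>
lemma no_two_red_cliques:
  assumes Q: "Q \<subseteq> V" "L \<le> card Q" "red_clique Q" and Q': "Q' \<subseteq> V" "L \<le> card Q'" "red_clique Q'"
    and blue: "\<forall>x\<in>Q. \<forall>y\<in>Q'. x \<noteq> y \<and> \<not> r x y"
  shows False
proof -
  define S where "S = (\<Sum>z\<in>V. f Q z + f Q' z)"
  have CS: "(\<Sum>z\<in>V. g z)\<^sup>2 \<le> N * (\<Sum>z\<in>V. (g z)\<^sup>2)" for g :: "nat \<Rightarrow> real"
    using Cauchy_Schwarz_ineq_sum[of "\<lambda>_. 1" g V] by simp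
  have half: "(\<Sum>z\<in>V. f P z) \<le> (289 / 1000) * N"
    if P: "P \<subseteq> V" "L \<le> card P" "red_clique P" for P
  proof (rule power2_le_imp_le)
    have "(\<Sum>z\<in>V. (f P z)\<^sup>2) \<le> 1 / 12 * N"
      using red_clique_sum[OF P] mult_pos_pos[OF \<delta>(1) N_pos] unfolding left_diff_distrib by linarith
    then have "(\<Sum>z\<in>V. f P z)\<^sup>2 \<le> N * (1 / 12 * N)"
      using CS[of "f P"] N_pos by (meson less_imp_le mult_left_mono order_trans)
    also have "\<dots> \<le> (289 / 1000 * N)\<^sup>2" using N_pos by (simp add: power2_eq_square)
    finally show "(\<Sum>z\<in>V. f P z)\<^sup>2 \<le> (289 / 1000 * N)\<^sup>2" .
  qed (use N_pos in simp)
  have S: "S \<le> (578 / 1000) * N"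
    using half[OF Q] half[OF Q'] by (simp add: S_def sum.distrib)
  have "(\<Sum>z\<in>V. (f Q z + f Q' z)\<^sup>2)
     = (\<Sum>z\<in>V. (f Q z)\<^sup>2 + (f Q' z)\<^sup>2 + 2 * ((1 - f Q z) * (1 - f Q' z)) + 2 * (f Q z + f Q' z) - 2)"
    by (intro sum.cong refl) (simp add: power2_eq_square algebra_simps)
  also have "\<dots> = (\<Sum>z\<in>V. (f Q z)\<^sup>2) + (\<Sum>z\<in>V. (f Q' z)\<^sup>2)
      + 2 * (\<Sum>z\<in>V. (1 - f Q z) * (1 - f Q' z)) + 2 * S - 2 * N"
    by (simp add: S_def sum.distrib sum_subtractf sum_distrib_left[symmetric])
  also have "\<dots> \<le> 2 * ((1 / 12 - \<delta> / 2) * N) + 2 * ((1 / 2 - \<delta>) * N) + 2 * S - 2 * N"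
    using red_clique_sum[OF Q] red_clique_sum[OF Q'] blue_pair_sum[OF Q(1,2) Q'(1,2) blue]
    by linarith
  also have "\<dots> \<le> 2 * S - 5 / 6 * N"
    using \<delta>(1) N_pos by (simp add: algebra_simps)
  finally have "N * (\<Sum>z\<in>V. (f Q z + f Q' z)\<^sup>2) \<le> N * (2 * S - 5 / 6 * N)"
    using N_pos by (intro mult_left_mono) auto
  then have "S\<^sup>2 \<le> N * (2 * S - 5 / 6 * N)"
    using CS[of "\<lambda>z. f Q z + f Q' z"] by (simp add: S_def)
  then have "(N - S)\<^sup>2 \<le> 1 / 6 * N\<^sup>2" by (simp add: power2_eq_square algebra_simps)
  moreover have "(422 / 1000 * N)\<^sup>2 \<le> (N - S)\<^sup>2"
    using S N_pos by (intro power_mono) auto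
  moreover have "0 < N\<^sup>2" using N_pos by simp
  ultimately show False by (simp add: power_mult_distrib power2_eq_square)
qed

text \<open>
  Hence many vertices are red to large parts of both cliques. Without the term \<open>\<delta>N\<close> the inequality
  would allow \<open>f\<^sub>1 + f\<^sub>2 = 1\<close> and \<open>f\<^sub>1f\<^sub>2 = 0\<close>, as for the two sides of a complete bipartite red graph.
\<close>
lemma blue_red_blue_sum:
  assumes Q: "Q \<subseteq> V" "L \<le> card Q" "blue_clique Q" and Q': "Q' \<subseteq> V" "L \<le> card Q'" "blue_clique Q'"
  shows "(\<Sum>z\<in>V. (f Q z + f Q' z - 1)\<^sup>2) + \<delta> * N \<le> 2 * (\<Sum>z\<in>V. f Q z * f Q' z)"
proof -
  have "(\<Sum>z\<in>V. (f Q z + f Q' z - 1)\<^sup>2)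
     = (\<Sum>z\<in>V. (1 - f Q z)\<^sup>2 + (1 - f Q' z)\<^sup>2 + 2 * (f Q z * f Q' z) - 1)"
    by (intro sum.cong refl) (simp add: power2_eq_square algebra_simps)
  also have "\<dots> = (\<Sum>z\<in>V. (1 - f Q z)\<^sup>2) + (\<Sum>z\<in>V. (1 - f Q' z)\<^sup>2)
      + 2 * (\<Sum>z\<in>V. f Q z * f Q' z) - N"
    by (simp add: sum.distrib sum_subtractf sum_distrib_left[symmetric])
  also have "\<dots> \<le> 2 * ((1 / 2 - \<delta> / 2) * N) + 2 * (\<Sum>z\<in>V. f Q z * f Q' z) - N"
    using blue_clique_sum[OF Q] blue_clique_sum[OF Q'] by linarith
  finally show ?thesis by (simp add: algebra_simps)
qed

end

section \<open>Red edges between blue cliques\<close>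

text \<open>
  In the application \<open>Z\<close> is a union of red \<open>k\<close>-cliques and \<open>Y\<close> contains no red \<open>k\<close>-clique. The clique sizes
  grow in the order \<open>L\<close>, \<open>L1\<close>, \<open>l0\<close>: a set of fewer than \<open>L\<close> vertices is negligible in one of \<open>L1\<close>
  vertices, and one of fewer than \<open>L1\<close> vertices is negligible in one of \<open>l0\<close>. The Ramsey bounds
  \<open>RL\<close>, \<open>R1\<close>, \<open>R0\<close> belong to these sizes.
\<close>
locale split_small_books = small_books V r \<delta> L
  for V :: "nat set" and r :: "nat \<Rightarrow> nat \<Rightarrow> bool" and \<delta> :: real and L :: nat +
  fixes Z Y :: "nat set" and L1 l0 RL R1 R0 :: nat
  assumes V_eq: "V = Z \<union> Y" and disj: "Z \<inter> Y = {}"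
    and RL: "U \<subseteq> Y \<Longrightarrow> RL \<le> card U \<Longrightarrow> \<exists>Q\<subseteq>U. card Q = L \<and> blue_clique Q"
    and R1: "U \<subseteq> Y \<Longrightarrow> R1 \<le> card U \<Longrightarrow> \<exists>Q\<subseteq>U. card Q = L1 \<and> blue_clique Q"
    and R0: "U \<subseteq> Y \<Longrightarrow> R0 \<le> card U \<Longrightarrow> \<exists>Q\<subseteq>U. card Q = l0 \<and> blue_clique Q"
    and R0_pos: "R0 > 0"
    and L1: "L \<le> L1" "8 * real L \<le> \<delta> * real L1"
    and l0: "L \<le> l0" "2 * real L1 \<le> \<delta> * real l0"
    and large: "2 ^ (l0 + L1) * RL \<le> \<delta> * N / 8"
begin

definition deg_Z :: "nat \<Rightarrow> real" where "deg_Z y = real (card {z \<in> Z. r y z})"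

lemma fin: "finite Z" "finite Y" using finV V_eq by auto

lemma N_eq: "N = card Z + card Y"
  using fin disj by (simp add: V_eq card_Un_disjoint)

lemma sum_V: "(\<Sum>z\<in>V. g z) = (\<Sum>z\<in>Z. g z) + (\<Sum>z\<in>Y. g z)" for g :: "nat \<Rightarrow> real"
  using fin disj by (simp add: V_eq sum.union_disjoint)

lemma deg_Z_bounds: "0 \<le> deg_Z y" "deg_Z y \<le> card Z"
  using fin by (auto simp: deg_Z_def card_mono)

lemma sum_f_Z:
  assumes "Q \<subseteq> V"
  shows "(\<Sum>z\<in>Z. f Q z) = (\<Sum>q\<in>Q. deg_Z q) / card Q"
  using sum_adj_density[OF fin(1) finQ[OF assms], of r] by (simp add: deg_Z_def)

text \<open>
  Sort the vertices in question by their red neighbourhoods in \<open>A\<close> and \<open>Q\<close>. A class with more than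
  \<open>RL\<close> members contains a blue clique that is joined in red to large subcliques of \<open>A\<close> and \<open>Q\<close>.
\<close>
lemma few_doubly_adjacent:
  assumes A: "A \<subseteq> V" "blue_clique A" and Q: "Q \<subseteq> V" "blue_clique Q"
    and red: "\<forall>x\<in>A. \<forall>y\<in>Q. r x y"
  shows "card {y \<in> Y. L \<le> card {a \<in> A. r a y} \<and> L \<le> card {q \<in> Q. r q y}}
          \<le> 2 ^ (card A + card Q) * RL"
proof -
  define U where "U = {y \<in> Y. L \<le> card {a \<in> A. r a y} \<and> L \<le> card {q \<in> Q. r q y}}"
  define t where "t y = ({a \<in> A. r a y}, {q \<in> Q. r q y})" for y
  have "card U \<le> card (Pow A \<times> Pow Q) * RL"
  proof (rule card_le_fibres[where t = t])
    fix AQ assume "AQ \<in> Pow A \<times> Pow Q"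
    show "card {u \<in> U. t u = AQ} \<le> RL"
    proof (rule ccontr)
      assume "\<not> card {u \<in> U. t u = AQ} \<le> RL"
      then obtain Q3 where Q3: "Q3 \<subseteq> {u \<in> U. t u = AQ}" "card Q3 = L" "blue_clique Q3"
        using RL[of "{u \<in> U. t u = AQ}"] by (auto simp: U_def)
      obtain A' Q' where AQ: "AQ = (A', Q')" by fastforce
      have eq: "A' = {a \<in> A. r a y}" "Q' = {q \<in> Q. r q y}" "y \<in> Y"
        "L \<le> card A'" "L \<le> card Q'" if "y \<in> Q3" for y
        using Q3(1) that by (auto simp: AQ t_def U_def)
      obtain y0 where y0: "y0 \<in> Q3" using Q3(2) L_pos by fastforce
      have sub: "A' \<subseteq> A" "Q' \<subseteq> Q" using eq[OF y0] by auto
      show False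
      proof (rule no_three_blue_cliques[of A' Q' Q3])
        show "Q3 \<subseteq> V" using eq(3) V_eq by auto
        show "\<forall>x\<in>A'. \<forall>y\<in>Q3. r x y" using eq(1) by blast
        show "\<forall>x\<in>Q'. \<forall>y\<in>Q3. r x y" using eq(2) by blast
        show "\<forall>x\<in>A'. \<forall>y\<in>Q'. r x y" using red sub by blast
        show "blue_clique A'" "blue_clique Q'"
          using A(2) Q(2) sub homogeneous_subset by blast+
      qed (use A Q Q3 sub red eq(4,5)[OF y0] in \<open>auto\<close>)
    qed
  qed (use finQ A Q fin in \<open>auto simp: t_def U_def\<close>)
  also have "card (Pow A \<times> Pow Q) = 2 ^ (card A + card Q)"
    using finQ A Q by (simp add: card_cartesian_product card_Pow power_add)
  finally show ?thesis by (simp add: U_def)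
qed

lemma L1_pos: "L1 > 0" "l0 > 0" using L1 l0 L_pos by auto

text \<open>
  A vertex with fewer than \<open>L\<close> red neighbours in one of the two cliques contributes at most \<open>\<delta>/8\<close>, and
  the number of all others is bounded independently of \<open>N\<close>, hence at most \<open>\<delta>N/8\<close>.
\<close>
lemma sum_Y_le:
  assumes A: "A \<subseteq> V" "L1 \<le> card A" "card A \<le> l0" "blue_clique A"
    and Q: "Q \<subseteq> V" "card Q = L1" "blue_clique Q"
    and red: "\<forall>x\<in>A. \<forall>y\<in>Q. r x y"
  shows "(\<Sum>y\<in>Y. f A y * f Q y) \<le> \<delta> / 4 * N"
proof -
  let ?U = "{y \<in> Y. L \<le> card {a \<in> A. r a y} \<and> L \<le> card {q \<in> Q. r q y}}"
  have f01: "0 \<le> f P y" "f P y \<le> 1" if "P \<subseteq> V" for P y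
    by (rule adj_density_bounds[OF finQ[OF that]])+
  have small: "f P y \<le> \<delta> / 8" if "P \<subseteq> V" "L1 \<le> card P" "\<not> L \<le> card {a \<in> P. r a y}" for P y
  proof -
    have "8 * real L \<le> \<delta> * card P"
    proof -
      have "\<delta> * real L1 \<le> \<delta> * real (card P)" using that(2) \<delta>(1) by (intro mult_left_mono) auto
      then show ?thesis using L1(2) by linarith
    qed
    then have "8 * real (card {a \<in> P. r a y}) \<le> \<delta> * card P" using that(3) by simp
    then show ?thesis using that(2) L1_pos by (simp add: adj_density_def field_simps)
  qed
  have "(\<Sum>y\<in>Y. f A y * f Q y) \<le> (\<Sum>y\<in>Y. \<delta> / 8 + of_bool (y \<in> ?U))"
  proof (rule sum_mono)
    fix y assume "y \<in> Y"
    consider "y \<in> ?U" | "\<not> L \<le> card {a \<in> A. r a y}" | "\<not> L \<le> card {a \<in> Q. r a y}"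
      using \<open>y \<in> Y\<close> by blast
    then show "f A y * f Q y \<le> \<delta> / 8 + of_bool (y \<in> ?U)"
    proof cases
      case 1
      then show ?thesis using f01[OF A(1), of y] f01[OF Q(1), of y] mult_mono[of "f A y" 1 "f Q y" 1] \<delta> by simp
    next
      case 2
      then have "f A y * f Q y \<le> \<delta> / 8 * 1"
        using small[OF A(1,2)] f01[OF Q(1), of y] f01[OF A(1), of y] \<delta> by (intro mult_mono) auto
      then show ?thesis by (simp add: add_increasing2)
    next
      case 3
      then have "f A y * f Q y \<le> 1 * (\<delta> / 8)"
        using small[of Q y] Q f01[OF Q(1), of y] f01[OF A(1), of y] \<delta> by (intro mult_mono) auto
      then show ?thesis by (simp add: add_increasing2)
    qed
  qed
  also have "\<dots> = card Y * (\<delta> / 8) + card ?U"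
    using fin by (simp add: sum.distrib of_bool_def sum.If_cases Int_def)
  also have "real (card Y) * (\<delta> / 8) \<le> N * (\<delta> / 8)"
    using N_eq \<delta> by (intro mult_right_mono) auto
  also have "real (card ?U) \<le> \<delta> * N / 8"
  proof -
    have "card ?U \<le> 2 ^ (card A + card Q) * RL"
      by (rule few_doubly_adjacent) (use A Q red in auto)
    also have "\<dots> \<le> 2 ^ (l0 + L1) * RL"
      using A(3) Q(2) by (intro mult_right_mono power_increasing) auto
    finally have "real (card ?U) \<le> real (2 ^ (l0 + L1) * RL)" by (rule of_nat_mono)
    then show ?thesis using large by simp
  qed
  finally show ?thesis by (simp add: algebra_simps)
qed

text \<open>
  With the part over \<open>Y\<close> bounded by \<open>sum_Y_le\<close>, the inequality for a red pair of blue
  cliques becomes \<open>\<Sum> (1 - f\<^sub>A)\<^sup>2 + \<Sum> (1 - f\<^sub>Q)\<^sup>2 < |Z|\<close> over \<open>Z\<close>, and by the Cauchy--Schwarz inequality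
  it passes to the means of \<open>1 - f\<^sub>A\<close> and \<open>1 - f\<^sub>Q\<close>.
\<close>
lemma red_degrees_into_Z:
  fixes m m' :: real
  assumes A: "A \<subseteq> V" "L1 \<le> card A" "card A \<le> l0" "blue_clique A"
    and Q: "Q \<subseteq> V" "card Q = L1" "blue_clique Q"
    and red: "\<forall>x\<in>A. \<forall>y\<in>Q. r x y"
    and m: "\<And>x. x \<in> A \<Longrightarrow> deg_Z x \<le> m" "\<And>y. y \<in> Q \<Longrightarrow> deg_Z y \<le> m'"
    and le: "m \<le> card Z" "m' \<le> card Z"
  shows "(card Z - m)\<^sup>2 + (card Z - m')\<^sup>2 < (card Z)\<^sup>2"
proof -
  let ?z = "real (card Z)"
  have *: "(?z - m)\<^sup>2 \<le> ?z * (\<Sum>z\<in>Z. (1 - f P z)\<^sup>2)"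
    if P: "P \<subseteq> V" "P \<noteq> {}" "\<And>x. x \<in> P \<Longrightarrow> deg_Z x \<le> m" "m \<le> card Z" for P m
  proof -
    have "(\<Sum>q\<in>P. deg_Z q) \<le> card P * m" using sum_mono[of P deg_Z "\<lambda>_. m"] P(3) by simp
    then have "?z - m \<le> (\<Sum>z\<in>Z. 1 - f P z)"
      using P finQ by (simp add: sum_subtractf sum_f_Z divide_le_eq card_gt_0_iff mult.commute)
    then have "(?z - m)\<^sup>2 \<le> (\<Sum>z\<in>Z. 1 - f P z)\<^sup>2" using P(4) by (intro power_mono) auto
    also have "\<dots> \<le> ?z * (\<Sum>z\<in>Z. (1 - f P z)\<^sup>2)"
      using Cauchy_Schwarz_ineq_sum[of "\<lambda>_. 1" "\<lambda>z. 1 - f P z" Z] by simp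
    finally show ?thesis .
  qed
  have ne: "A \<noteq> {}" "Q \<noteq> {}" using A(2) Q(2) L1_pos by auto
  have "(\<Sum>z\<in>V. (f A z + f Q z - 1)\<^sup>2) + \<delta> * N \<le> 2 * (\<Sum>z\<in>V. f A z * f Q z)"
    using A Q L1(1) by (intro blue_red_blue_sum) auto
  moreover have "(\<Sum>z\<in>Y. f A z * f Q z) \<le> \<delta> / 4 * N" by (rule sum_Y_le[OF A Q red])
  moreover have "0 \<le> (\<Sum>z\<in>Y. (f A z + f Q z - 1)\<^sup>2)" by (intro sum_nonneg) simp
  ultimately have "(\<Sum>z\<in>Z. (f A z + f Q z - 1)\<^sup>2) + \<delta> / 2 * N \<le> 2 * (\<Sum>z\<in>Z. f A z * f Q z)"
    unfolding sum_V by simp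
  moreover have "(\<Sum>z\<in>Z. (f A z + f Q z - 1)\<^sup>2)
      = (\<Sum>z\<in>Z. (1 - f A z)\<^sup>2) + (\<Sum>z\<in>Z. (1 - f Q z)\<^sup>2) + 2 * (\<Sum>z\<in>Z. f A z * f Q z) - ?z"
  proof -
    have "(\<Sum>z\<in>Z. (f A z + f Q z - 1)\<^sup>2)
      = (\<Sum>z\<in>Z. (1 - f A z)\<^sup>2 + (1 - f Q z)\<^sup>2 + 2 * (f A z * f Q z) - 1)"
      by (intro sum.cong refl) (simp add: power2_eq_square algebra_simps)
    then show ?thesis by (simp add: sum.distrib sum_subtractf sum_distrib_left[symmetric])
  qed
  ultimately have main: "(\<Sum>z\<in>Z. (1 - f A z)\<^sup>2) + (\<Sum>z\<in>Z. (1 - f Q z)\<^sup>2) \<le> ?z - \<delta> / 2 * N"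
    by linarith
  have dN: "0 < \<delta> / 2 * N" using \<delta>(1) N_pos by simp
  have "0 \<le> (\<Sum>z\<in>Z. (1 - f A z)\<^sup>2)" "0 \<le> (\<Sum>z\<in>Z. (1 - f Q z)\<^sup>2)" by (simp_all add: sum_nonneg)
  then have z: "?z > 0" using main dN by linarith
  have "(?z - m)\<^sup>2 + (?z - m')\<^sup>2 \<le> ?z * ((\<Sum>z\<in>Z. (1 - f A z)\<^sup>2) + (\<Sum>z\<in>Z. (1 - f Q z)\<^sup>2))"
    using *[OF A(1) ne(1) m(1) le(1)] *[OF Q(1) ne(2) m(2) le(2)] by (simp add: distrib_left)
  also have "\<dots> \<le> ?z * (?z - \<delta> / 2 * N)" using main by (intro mult_left_mono) auto
  also have "\<dots> < ?z * ?z" using z dN by (intro mult_strict_left_mono) auto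
  finally show ?thesis by (simp add: power2_eq_square)
qed

definition well_joined :: "nat set \<Rightarrow> nat set" where
  "well_joined Q = {y \<in> Y. L1 \<le> card {q \<in> Q. r q y}}"

text \<open>
  A large set of such vertices with the same red neighbourhood in \<open>Q\<close> would contain a blue clique
  joined in red to a subclique of \<open>Q\<close>, with both red degrees into \<open>Z\<close> too small. The hypothesis
  \<open>m\<close> bounds the degree of each single vertex of \<open>Q\<close>, and hence survives the passage to a subclique.
\<close>
lemma few_low_degree:
  fixes m m' :: real
  assumes Q: "Q \<subseteq> V" "card Q = l0" "blue_clique Q"
    and m: "\<And>x. x \<in> Q \<Longrightarrow> deg_Z x \<le> m" "m \<le> card Z" "m' \<le> card Z"
    and sq: "(card Z - m)\<^sup>2 + (card Z - m')\<^sup>2 \<ge> (card Z)\<^sup>2"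
  shows "card {y \<in> well_joined Q. deg_Z y \<le> m'} \<le> 2 ^ l0 * R1"
proof -
  let ?U = "{y \<in> well_joined Q. deg_Z y \<le> m'}"
  define t where "t y = {q \<in> Q. r q y}" for y
  have "card ?U \<le> card (Pow Q) * R1"
  proof (rule card_le_fibres[where t = t])
    fix A assume "A \<in> Pow Q"
    show "card {u \<in> ?U. t u = A} \<le> R1"
    proof (rule ccontr)
      assume "\<not> card {u \<in> ?U. t u = A} \<le> R1"
      then obtain Q' where Q': "Q' \<subseteq> {u \<in> ?U. t u = A}" "card Q' = L1" "blue_clique Q'"
        using R1[of "{u \<in> ?U. t u = A}"] by (auto simp: well_joined_def)
      have eq: "A = {q \<in> Q. r q y}" "y \<in> Y" "L1 \<le> card A" "deg_Z y \<le> m'" if "y \<in> Q'" for y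
        using Q'(1) that by (auto simp: t_def well_joined_def)
      obtain y0 where y0: "y0 \<in> Q'" using Q'(2) L1_pos by fastforce
      have A: "A \<subseteq> Q" "card A \<le> l0" using eq(1)[OF y0] Q finQ by (auto intro: card_mono)
      have "(card Z - m)\<^sup>2 + (card Z - m')\<^sup>2 < (card Z)\<^sup>2"
      proof (rule red_degrees_into_Z[of A Q'])
        show "\<forall>x\<in>A. \<forall>y\<in>Q'. r x y" using eq(1) by blast
        show "Q' \<subseteq> V" using eq(2) V_eq by auto
        show "blue_clique A" by (rule homogeneous_subset[OF Q(3) A(1)])
      qed (use A Q Q' m eq eq(3)[OF y0] in auto)
      then show False using sq by linarith
    qed
  qed (use finQ Q fin in \<open>auto simp: t_def well_joined_def\<close>)
  also have "card (Pow Q) = 2 ^ l0" using finQ Q by (simp add: card_Pow)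
  finally show ?thesis .
qed

text \<open>
  The sum of \<open>(1 - f\<^sub>Q)\<^sup>2\<close> is at most \<open>N/2\<close>, and at least \<open>|Z|/2\<close> of it comes from \<open>Z\<close>. A vertex of \<open>Y\<close>
  with few red edges to \<open>Q\<close> contributes almost \<open>1\<close>, so that there are at most \<open>(N - |Z|)/2 = |Y|/2\<close> of
  them.
\<close>
lemma many_red_to_Q:
  fixes m :: real
  assumes Q: "Q \<subseteq> V" "card Q = l0" "blue_clique Q"
    and m: "\<And>x. x \<in> Q \<Longrightarrow> deg_Z x \<le> m" "m \<le> card Z"
    and sq: "2 * (card Z - m)\<^sup>2 \<ge> (card Z)\<^sup>2"
  shows "card Y \<le> 2 * card (well_joined Q)"
proof -
  let ?z = "real (card Z)"
  have GY: "well_joined Q \<subseteq> Y" by (auto simp: well_joined_def)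
  have "?z / 2 \<le> (\<Sum>z\<in>Z. (1 - f Q z)\<^sup>2)"
  proof (cases "?z = 0")
    case True then show ?thesis using fin by simp
  next
    case False
    have Qne: "Q \<noteq> {}" using Q L1_pos by auto
    have "(\<Sum>q\<in>Q. deg_Z q) \<le> card Q * m" using sum_mono[of Q deg_Z "\<lambda>_. m"] m(1) by simp
    then have "?z - m \<le> (\<Sum>z\<in>Z. 1 - f Q z)"
      using Q finQ Qne L1_pos(2) by (simp add: sum_subtractf sum_f_Z divide_le_eq card_gt_0_iff mult.commute)
    then have "(?z - m)\<^sup>2 \<le> (\<Sum>z\<in>Z. 1 - f Q z)\<^sup>2" using m(2) by (intro power_mono) auto
    also have "\<dots> \<le> ?z * (\<Sum>z\<in>Z. (1 - f Q z)\<^sup>2)"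
      using Cauchy_Schwarz_ineq_sum[of "\<lambda>_. 1" "\<lambda>z. 1 - f Q z" Z] by simp
    finally have "?z * ?z \<le> ?z * (2 * (\<Sum>z\<in>Z. (1 - f Q z)\<^sup>2))"
      using sq by (simp add: power2_eq_square)
    then have "?z \<le> 2 * (\<Sum>z\<in>Z. (1 - f Q z)\<^sup>2)"
      using False by (simp add: mult_le_cancel_left)
    then show ?thesis by simp
  qed
  moreover have "(1 - \<delta>) * card (Y - well_joined Q) \<le> (\<Sum>y\<in>Y. (1 - f Q y)\<^sup>2)"
  proof -
    have "1 - \<delta> \<le> (1 - f Q y)\<^sup>2" if "y \<in> Y - well_joined Q" for y
    proof -
      have "2 * real (card {q \<in> Q. r q y}) \<le> \<delta> * l0"
      proof -
        have "real (card {q \<in> Q. r q y}) \<le> real L1" using that by (auto simp: well_joined_def)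
        then show ?thesis using l0(2) by linarith
      qed
      then have "2 * f Q y \<le> \<delta>" using Q(2) L1_pos by (simp add: adj_density_def field_simps)
      moreover have "1 - 2 * f Q y \<le> (1 - f Q y)\<^sup>2" by (simp add: power2_eq_square algebra_simps)
      ultimately show ?thesis by linarith
    qed
    then have "(\<Sum>y\<in>Y - well_joined Q. 1 - \<delta>) \<le> (\<Sum>y\<in>Y - well_joined Q. (1 - f Q y)\<^sup>2)" by (rule sum_mono)
    also have "\<dots> \<le> (\<Sum>y\<in>Y. (1 - f Q y)\<^sup>2)" using fin by (intro sum_mono2) auto
    finally show ?thesis by (simp add: mult.commute)
  qed
  moreover have "(\<Sum>z\<in>V. (1 - f Q z)\<^sup>2) \<le> (1 / 2 - \<delta> / 2) * N"
    using blue_clique_sum[OF Q(1) _ Q(3)] Q(2) l0(1) by simp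
  ultimately have "(1 - \<delta>) * card (Y - well_joined Q) + ?z / 2 \<le> (1 / 2 - \<delta> / 2) * N"
    unfolding sum_V by linarith
  also have "\<dots> = (1 - \<delta>) * (card Y / 2) + (1 - \<delta>) * (?z / 2)"
    unfolding N_eq by (simp add: field_simps)
  also have "\<dots> \<le> (1 - \<delta>) * (card Y / 2) + ?z / 2"
    using \<delta> mult_right_mono[of "1 - \<delta>" 1 "?z / 2"] by simp
  finally have "(1 - \<delta>) * card (Y - well_joined Q) \<le> (1 - \<delta>) * (card Y / 2)" by simp
  then have "real (card (Y - well_joined Q)) \<le> card Y / 2" using \<delta> by simp
  moreover have "real (card (Y - well_joined Q)) = real (card Y) - real (card (well_joined Q))"
    using GY fin by (simp add: card_Diff_subset finite_subset of_nat_diff card_mono)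
  ultimately show ?thesis by linarith
qed

end

section \<open>Red density between the two parts\<close>

context split_small_books
begin

text \<open>
  An upper bound on the number of vertices of \<open>Y\<close> that are exceptional in \<open>sum_deg_Z_lower_bound\<close>;
  it does not depend on \<open>N\<close>.
\<close>
definition slack :: nat where "slack = 2 ^ l0 * R1 + R0"

lemma R0_le_slack: "R0 \<le> slack" by (simp add: slack_def)

text \<open>
  The clique lies among the \<open>R0\<close> vertices of lowest degree into \<open>Z\<close>, so that the largest degree \<open>m\<close>
  of these is also a lower bound for the degrees of all other vertices of \<open>Y\<close>.
\<close>
lemma low_degree_clique:
  assumes "R0 \<le> card Y"
  obtains U Q m where "U \<subseteq> Y" "card U = R0" "Q \<subseteq> U" "card Q = l0" "blue_clique Q"
    "\<And>x. x \<in> U \<Longrightarrow> deg_Z x \<le> m" "\<And>y. y \<in> Y - U \<Longrightarrow> m \<le> deg_Z y" "0 \<le> m" "m \<le> card Z"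
proof -
  obtain U where U: "U \<subseteq> Y" "card U = R0" "\<And>x y. x \<in> U \<Longrightarrow> y \<in> Y - U \<Longrightarrow> deg_Z x \<le> deg_Z y"
    using subset_with_smallest_values[OF fin(2) assms, of deg_Z] by blast
  obtain Q where Q: "Q \<subseteq> U" "card Q = l0" "blue_clique Q"
    using R0[of U] U by auto
  have U': "finite U" "U \<noteq> {}" using U R0_pos by (auto simp: card_gt_0_iff)
  have "Max (deg_Z ` U) \<in> deg_Z ` U" using U' by (intro Max_in) auto
  then obtain x0 where x0: "x0 \<in> U" "Max (deg_Z ` U) = deg_Z x0" by auto
  show ?thesis
  proof (rule that[OF U(1,2) Q])
    show "deg_Z x \<le> deg_Z x0" if "x \<in> U" for x using that U' by (simp flip: x0(2))
    show "deg_Z x0 \<le> deg_Z y" if "y \<in> Y - U" for y using U(3) x0(1) that by blast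
  qed (use deg_Z_bounds in auto)
qed

text \<open>
  If \<open>Z\<close> is empty, then all degrees into \<open>Z\<close> are zero, so the vertices of \<open>Y\<close> with many red edges to
  a given blue clique all count as vertices of low degree. They are at least half of all vertices, but
  the number of vertices of low degree is bounded.
\<close>
lemma Z_nonempty:
  assumes big: "2 * real slack < N"
  shows "Z \<noteq> {}"
proof
  assume Z: "Z = {}"
  then have Y: "Y = V" using V_eq by simp
  have "R0 \<le> card Y" using big R0_le_slack unfolding Y by linarith
  then obtain U Q where Q: "U \<subseteq> Y" "Q \<subseteq> U" "card Q = l0" "blue_clique Q"
    using low_degree_clique by metis
  have c0: "real (card Z) = 0" using Z by simp
  have s0: "deg_Z x = 0" for x using deg_Z_bounds[of x] c0 by linarith
  have QV: "Q \<subseteq> V" using Q Y by auto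
  have "card {y \<in> well_joined Q. deg_Z y \<le> 0} \<le> 2 ^ l0 * R1"
    by (rule few_low_degree[OF QV Q(3,4), of 0]) (use c0 s0 in simp_all)
  then have "card (well_joined Q) \<le> slack" using s0 by (simp add: slack_def)
  moreover have "card Y \<le> 2 * card (well_joined Q)"
    by (rule many_red_to_Q[OF QV Q(3,4), of 0]) (use c0 s0 in simp_all)
  ultimately show False using big Y by simp
qed

text \<open>
  Let \<open>m\<close> be essentially the smallest red degree into \<open>Z\<close>, and write \<open>z = |Z|\<close> and \<open>u = z - m\<close>. If
  \<open>u\<^sup>2 < z\<^sup>2/2\<close>, all degrees are large enough. Otherwise half of \<open>Y\<close> sees the clique of lowest degree
  in red, and these vertices have degree at least \<open>z - v\<close>, where \<open>u\<^sup>2 + v\<^sup>2 = z\<^sup>2\<close>, with boundedly many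
  exceptions. The mean degree is then essentially at least \<open>z - (u + v)/2 \<ge> (1 - 1/\<surd>2)z\<close>. The constant \<open>29/100\<close> lies below \<open>1 - 1/\<surd>2\<close>, and its
  square is still above \<open>1/12\<close>.
\<close>
lemma sum_deg_Z_lower_bound:
  "29 / 100 * real (card Z) * real (card Y) - real slack * real (card Z) \<le> (\<Sum>y\<in>Y. deg_Z y)"
proof (cases "R0 \<le> card Y")
  case False
  have "29 / 100 * real (card Z) * real (card Y) \<le> 1 * real (card Z) * real slack"
    using False R0_le_slack by (intro mult_mono) auto
  moreover have "0 \<le> (\<Sum>y\<in>Y. deg_Z y)" by (intro sum_nonneg deg_Z_bounds)
  ultimately show ?thesis by (simp add: mult.commute)
next
  case True
  then obtain U Q m where U: "U \<subseteq> Y" "card U = R0" and Q: "Q \<subseteq> U" "card Q = l0" "blue_clique Q"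
    and mU: "\<And>x. x \<in> U \<Longrightarrow> deg_Z x \<le> m" and mY: "\<And>y. y \<in> Y - U \<Longrightarrow> m \<le> deg_Z y"
    and m: "0 \<le> m" "m \<le> card Z"
    using low_degree_clique by blast
  have QV: "Q \<subseteq> V" using Q U V_eq by auto
  have mQ: "\<And>x. x \<in> Q \<Longrightarrow> deg_Z x \<le> m" using mU Q(1) by blast
  define z where "z = real (card Z)"
  define u where "u = z - m"
  have u: "0 \<le> u" "u \<le> z" using m by (simp_all add: u_def z_def)
  \<comment> \<open>By \<open>red_degrees_into_Z\<close>, two cliques joined in red cannot have degrees up to \<open>m\<close> and up to \<open>z - v\<close>.\<close>
  define v where "v = sqrt (z\<^sup>2 - u\<^sup>2)"
  have uz: "u\<^sup>2 \<le> z\<^sup>2" using u by (intro power_mono)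
  have v2: "u\<^sup>2 + v\<^sup>2 = z\<^sup>2" and v0: "0 \<le> v" using uz by (simp_all add: v_def)
  have vz: "v \<le> z" using v2 u zero_le_power2[of u] by (intro power2_le_imp_le[of v z]) linarith+
  have uv: "u + v \<le> 142 / 100 * z"
  proof (rule power2_le_imp_le)
    have "0 \<le> (u - v)\<^sup>2" by simp
    then have "(u + v)\<^sup>2 \<le> 2 * z\<^sup>2" using v2 by (simp add: power2_eq_square algebra_simps)
    also have "\<dots> \<le> (142 / 100 * z)\<^sup>2" by (simp add: power2_eq_square)
    finally show "(u + v)\<^sup>2 \<le> (142 / 100 * z)\<^sup>2" .
  qed (use u in simp)
  \<comment> \<open>Outside the exceptional set \<open>bad \<union> U\<close> of bounded size, \<open>g\<close> is a lower bound for the degrees.\<close>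
  define bad where "bad = {y \<in> well_joined Q. deg_Z y \<le> z - v}"
  define g where "g y = (if y \<in> well_joined Q then max m (z - v) else m)" for y
  have GY: "well_joined Q \<subseteq> Y" by (auto simp: well_joined_def)
  have bad: "card bad \<le> 2 ^ l0 * R1"
    unfolding bad_def
    by (rule few_low_degree[OF QV Q(2,3) mQ m(2)])
      (use v2 v0 in \<open>simp_all add: u_def z_def\<close>)
  have g: "g y \<le> deg_Z y" if "y \<in> Y - (bad \<union> U)" for y
    using that mY by (auto simp: g_def bad_def)
  have gz: "g y \<le> z" for y using u v0 by (auto simp: g_def u_def)
  have finBU: "finite (bad \<union> U)" "bad \<union> U \<subseteq> Y"
    using U GY fin by (auto simp: bad_def finite_subset)
  have "(\<Sum>y\<in>bad \<union> U. g y) \<le> real slack * z"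
  proof -
    have "(\<Sum>y\<in>bad \<union> U. g y) \<le> (\<Sum>y\<in>bad \<union> U. z)" by (intro sum_mono gz)
    also have "\<dots> = real (card (bad \<union> U)) * z" by simp
    also have "card (bad \<union> U) \<le> slack" using card_Un_le[of bad U] bad U by (simp add: slack_def)
    finally show ?thesis using u by (simp add: mult_right_mono)
  qed
  moreover have "(\<Sum>y\<in>Y. g y) = (\<Sum>y\<in>Y - (bad \<union> U). g y) + (\<Sum>y\<in>bad \<union> U. g y)"
    using finBU fin by (intro sum.subset_diff) auto
  moreover have "(\<Sum>y\<in>Y - (bad \<union> U). g y) \<le> (\<Sum>y\<in>Y - (bad \<union> U). deg_Z y)"
    by (intro sum_mono g)
  moreover have "(\<Sum>y\<in>Y - (bad \<union> U). deg_Z y) \<le> (\<Sum>y\<in>Y. deg_Z y)"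
    by (rule sum_mono2) (use fin deg_Z_bounds in auto)
  moreover have "29 / 100 * z * real (card Y) \<le> (\<Sum>y\<in>Y. g y)"
  proof (cases "z\<^sup>2 \<le> 2 * u\<^sup>2")
    case True
    then have "v\<^sup>2 \<le> u\<^sup>2" using v2 by linarith
    then have vu: "v \<le> u" using u(1) by (rule power2_le_imp_le)
    then have gm: "g y = m + of_bool (y \<in> well_joined Q) * (u - v)" for y
      by (auto simp: g_def u_def)
    have "card Y \<le> 2 * card (well_joined Q)"
      by (rule many_red_to_Q[OF QV Q(2,3) mQ m(2)]) (use True in \<open>simp_all add: u_def z_def\<close>)
    then have half: "real (card Y) / 2 \<le> card (well_joined Q)" by linarith
    have "29 / 100 * z * real (card Y) \<le> card Y * (m + (u - v) / 2)"
    proof -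
      have "29 / 100 * z \<le> m + (u - v) / 2" using uv by (simp add: u_def field_simps)
      from mult_right_mono[OF this, of "real (card Y)"] show ?thesis by (simp add: mult.commute)
    qed
    also have "\<dots> = card Y * m + real (card Y) / 2 * (u - v)" by (simp add: algebra_simps)
    also have "\<dots> \<le> card Y * m + card (well_joined Q) * (u - v)"
      using half vu by (intro add_left_mono mult_right_mono) auto
    also have "\<dots> = (\<Sum>y\<in>Y. g y)"
    proof -
      have "{y \<in> Y. y \<in> well_joined Q} = well_joined Q" using GY by auto
      then have "(\<Sum>y\<in>Y. of_bool (y \<in> well_joined Q) * (u - v)) = card (well_joined Q) * (u - v)"
        using fin by (simp add: of_bool_def sum.If_cases Int_def flip: sum_distrib_right)
      then show ?thesis by (simp add: gm sum.distrib)
    qed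
    finally show ?thesis .
  next
    case False
    have "u \<le> 71 / 100 * z"
    proof (rule power2_le_imp_le)
      have "u\<^sup>2 \<le> 1 / 2 * z\<^sup>2" using False by simp
      also have "\<dots> \<le> 5041 / 10000 * z\<^sup>2" by (intro mult_right_mono) auto
      finally show "u\<^sup>2 \<le> (71 / 100 * z)\<^sup>2" by (simp add: power2_eq_square)
    qed (use u in simp)
    then have "29 / 100 * z \<le> m" by (simp add: u_def)
    moreover have "m \<le> g y" for y by (simp add: g_def)
    ultimately have "29 / 100 * z \<le> g y" for y using order_trans by blast
    then have "(\<Sum>y\<in>Y. 29 / 100 * z) \<le> (\<Sum>y\<in>Y. g y)" by (intro sum_mono)
    then show ?thesis by (simp add: mult.commute)
  qed
  ultimately show ?thesis by (simp add: z_def)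
qed

text \<open>
  Sorted by their blue neighbourhoods in \<open>P'\<close>, these vertices of \<open>P\<close> fall into classes, and a class
  with more than \<open>L\<close> members would be a red clique joined in blue to another one. The case \<open>P' \<subseteq> P\<close>
  arises because \<open>P'\<close> is chosen inside one of the cliques that make up \<open>Z\<close>.
\<close>
lemma few_blue_between_red_cliques:
  assumes P': "P' \<subseteq> V" "red_clique P'" and P: "P \<subseteq> V" "red_clique P" and "P' \<subseteq> P \<or> P' \<inter> P = {}"
    and L2: "2 \<le> L"
  shows "card {z \<in> P. L \<le> card {x \<in> P'. \<not> r x z}} \<le> 2 ^ card P' * L"
  using assms(5)
proof
  assume sub: "P' \<subseteq> P"
  have "card {x \<in> P'. \<not> r x z} \<le> 1" if "z \<in> P" for z
  proof -
    have "{x \<in> P'. \<not> r x z} \<subseteq> {z}" using P(2) sub that by (auto simp: homogeneous_def)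
    then show ?thesis using card_mono[of "{z}"] by fastforce
  qed
  then have empty: "{z \<in> P. L \<le> card {x \<in> P'. \<not> r x z}} = {}" using L2 by fastforce
  show ?thesis unfolding empty by simp
next
  assume dis: "P' \<inter> P = {}"
  let ?U = "{z \<in> P. L \<le> card {x \<in> P'. \<not> r x z}}"
  define t where "t z = {x \<in> P'. \<not> r x z}" for z
  have "card ?U \<le> card (Pow P') * L"
  proof (rule card_le_fibres[where t = t])
    fix B assume "B \<in> Pow P'"
    let ?F = "{u \<in> ?U. t u = B}"
    show "card ?F \<le> L"
    proof (rule ccontr)
      assume big: "\<not> card ?F \<le> L"
      then have "?F \<noteq> {}" by (metis card.empty le0)
      then obtain u0 where "u0 \<in> ?F" by blast
      then have B: "L \<le> card B" "B \<subseteq> P'" by (auto simp: t_def)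
      show False
      proof (rule no_two_red_cliques[of B ?F])
        show "red_clique B" by (rule homogeneous_subset[OF P'(2) B(2)])
        show "red_clique ?F" by (rule homogeneous_subset[OF P(2)]) auto
        show "\<forall>x\<in>B. \<forall>y\<in>?F. x \<noteq> y \<and> \<not> r x y" using dis by (auto simp: t_def)
      qed (use B P' P big in auto)
    qed
  qed (use finQ P P' in \<open>auto simp: t_def\<close>)
  then show ?thesis using finQ P' by (simp add: card_Pow)
qed

text \<open>
  Among the cliques that make up \<open>Z\<close> choose one with at least average red degree into \<open>Y\<close>, and in
  it a subclique \<open>P'\<close> of constant size \<open>2L\<close>, again with at least average degree. The size of \<open>P'\<close> is
  constant so that each of the much larger cliques in \<open>Z\<close> is mostly red to \<open>P'\<close>. The values of \<open>f\<^sub>P'\<close>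
  then contradict \<open>red_clique_sum\<close> unless \<open>N\<close> is bounded.
\<close>
lemma bounded_size:
  assumes \<C>: "disjoint \<C>" "\<Union>\<C> = Z" "\<And>P. P \<in> \<C> \<Longrightarrow> card P = k \<and> red_clique P"
    and L2: "2 \<le> L" and k: "2 * (2 ^ (2 * L) * L) \<le> k" "2 * L \<le> k"
  shows "\<delta> * N \<le> 4 * slack"
proof (cases "2 * real slack < N")
  case False
  have "\<delta> * N \<le> 1 * N" using \<delta> N_pos by (intro mult_right_mono) auto
  then show ?thesis using False by linarith
next
  case True
  let ?z = "real (card Z)" and ?y = "real (card Y)"
  define d where "d x = real (card {y \<in> Y. r x y})" for x
  have fin\<C>: "finite \<C>" using \<C>(2) fin(1) finite_UnionD by blast
  have PZ: "P \<subseteq> Z" "finite P" if "P \<in> \<C>" for P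
  proof -
    show "P \<subseteq> Z" using \<C>(2) that by auto
    then show "finite P" using fin(1) by (rule finite_subset)
  qed
  have zpos: "?z > 0" using Z_nonempty[OF True] fin by (simp add: card_gt_0_iff)
  have sum_Z: "(\<Sum>z\<in>Z. g z) = (\<Sum>P\<in>\<C>. \<Sum>z\<in>P. g z)" for g :: "nat \<Rightarrow> real"
    using sum.Union_disjoint_sets[of \<C> g] \<C>(1,2) PZ(2) by simp
  have card_Z: "?z = card \<C> * k"
    using sum_Z[of "\<lambda>_. 1"] \<C>(3) by simp
  define t where "t = 29 / 100 * ?y - slack"
  have "\<exists>P\<in>\<C>. (\<Sum>x\<in>P. d x) \<ge> k * t"
  proof (rule ccontr)
    assume neg: "\<not> (\<exists>P\<in>\<C>. (\<Sum>x\<in>P. d x) \<ge> k * t)"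
    have ne: "\<C> \<noteq> {}" using zpos card_Z by auto
    have "(\<Sum>z\<in>Z. d z) = (\<Sum>y\<in>Y. deg_Z y)"
    proof -
      have "(\<Sum>z\<in>Z. d z) = (\<Sum>z\<in>Z. \<Sum>y\<in>Y. of_bool (r z y))"
        using fin by (simp add: d_def of_bool_def sum.If_cases Int_def)
      also have "\<dots> = (\<Sum>y\<in>Y. \<Sum>z\<in>Z. of_bool (r z y))" by (rule sum.swap)
      also have "\<dots> = (\<Sum>y\<in>Y. \<Sum>z\<in>Z. of_bool (r y z))"
        by (intro sum.cong refl arg_cong[of _ _ of_bool] red_commute)
      also have "\<dots> = (\<Sum>y\<in>Y. deg_Z y)"
        using fin by (simp add: deg_Z_def of_bool_def sum.If_cases Int_def)
      finally show ?thesis .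
    qed
    then have "?z * t \<le> (\<Sum>P\<in>\<C>. \<Sum>z\<in>P. d z)"
      using sum_deg_Z_lower_bound sum_Z[of d] by (simp add: t_def algebra_simps)
    also have "\<dots> < (\<Sum>P\<in>\<C>. k * t)"
      using neg by (intro sum_strict_mono fin\<C> ne) (auto simp: not_le)
    finally show False using card_Z by simp
  qed
  then obtain P where P: "P \<in> \<C>" "(\<Sum>x\<in>P. d x) \<ge> k * t" by blast
  have PV: "P \<subseteq> V" using PZ[OF P(1)] V_eq by auto
  obtain P' where P': "P' \<subseteq> P" "card P' = 2 * L" "(\<Sum>x\<in>P'. d x) \<ge> (2 * L) * t"
    using subset_with_large_average[of P "2 * L" t d] PZ(2)[OF P(1)] \<C>(3)[OF P(1)] k(2) P(2)
    by auto
  have P'V: "P' \<subseteq> V" "finite P'" using P'(1) PV finQ by auto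
  have red: "red_clique P'" using homogeneous_subset P'(1) \<C>(3)[OF P(1)] by blast
  have "t \<le> (\<Sum>y\<in>Y. f P' y)"
    using P'(2,3) L_pos by (simp add: sum_adj_density[OF fin(2) P'V(2)] d_def field_simps)
  \<comment> \<open>The tangent of the square at \<open>29/100\<close> replaces the Cauchy--Schwarz inequality here, because
    it needs no information about the sign of \<open>t\<close>.\<close>
  moreover have "(\<Sum>y\<in>Y. 2 * (29 / 100) * f P' y - (29 / 100)\<^sup>2) \<le> (\<Sum>y\<in>Y. (f P' y)\<^sup>2)"
  proof (rule sum_mono)
    fix y
    have "0 \<le> (f P' y - 29 / 100)\<^sup>2" by simp
    then show "2 * (29 / 100) * f P' y - (29 / 100)\<^sup>2 \<le> (f P' y)\<^sup>2"
      by (simp add: power2_eq_square algebra_simps)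
  qed
  then have "2 * (29 / 100) * (\<Sum>y\<in>Y. f P' y) - (29 / 100)\<^sup>2 * ?y \<le> (\<Sum>y\<in>Y. (f P' y)\<^sup>2)"
    by (subst (asm) sum_subtractf, subst (asm) sum_distrib_left[symmetric]) (simp add: mult.commute)
  ultimately have Y_part: "?y / 12 - 58 / 100 * slack \<le> (\<Sum>y\<in>Y. (f P' y)\<^sup>2)"
    by (simp add: t_def power2_eq_square)
  \<comment> \<open>At least half of every clique in \<open>Z\<close> has \<open>f\<^sub>P' \<ge> 1/2\<close>, which gives \<open>k/8\<close>, more than \<open>k/12\<close>.\<close>
  have Z_part: "?z / 12 \<le> (\<Sum>z\<in>Z. (f P' z)\<^sup>2)"
  proof -
    have "real k / 12 \<le> (\<Sum>z\<in>P1. (f P' z)\<^sup>2)" if P1: "P1 \<in> \<C>" for P1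
    proof -
      let ?U = "{z \<in> P1. L \<le> card {x \<in> P'. \<not> r x z}}"
      have "P' \<subseteq> P1 \<or> P' \<inter> P1 = {}"
        using \<C>(1) P(1) P1 P'(1) by (auto simp: disjoint_def)
      then have "card ?U \<le> 2 ^ card P' * L"
        using few_blue_between_red_cliques[OF P'V(1) red _ _ _ L2] PZ(1)[OF P1] V_eq \<C>(3)[OF P1]
        by blast
      then have "2 * card ?U \<le> k" using k(1) P'(2) by simp
      moreover have "real (card (P1 - ?U)) = real k - card ?U"
      proof -
        have "card ?U \<le> card P1" using PZ(2)[OF P1] by (intro card_mono) auto
        moreover have "card (P1 - ?U) = card P1 - card ?U"
          using PZ(2)[OF P1] by (intro card_Diff_subset) auto
        ultimately show ?thesis using \<C>(3)[OF P1] by (simp add: of_nat_diff)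
      qed
      ultimately have "real k / 2 \<le> card (P1 - ?U)" by linarith
      moreover have "(\<Sum>z\<in>P1 - ?U. 1 / 4) \<le> (\<Sum>z\<in>P1 - ?U. (f P' z)\<^sup>2)"
      proof (rule sum_mono)
        fix z assume "z \<in> P1 - ?U"
        then have "real (card {x \<in> P'. \<not> r x z}) \<le> L" by auto
        then have "adj_density (\<lambda>x z. \<not> r x z) P' z \<le> 1 / 2"
          using P'(2) L_pos by (simp add: adj_density_def field_simps)
        then have "1 / 2 \<le> f P' z" using one_minus_f[OF P'V(1), of z] P'(2) by simp
        then have "(1 / 2)\<^sup>2 \<le> (f P' z)\<^sup>2" by (intro power_mono) auto
        then show "1 / 4 \<le> (f P' z)\<^sup>2" by (simp add: power2_eq_square)
      qed
      moreover have "(\<Sum>z\<in>P1 - ?U. (f P' z)\<^sup>2) \<le> (\<Sum>z\<in>P1. (f P' z)\<^sup>2)"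
        using PZ(2)[OF P1] by (intro sum_mono2) auto
      ultimately show ?thesis by simp
    qed
    then have "(\<Sum>P1\<in>\<C>. real k / 12) \<le> (\<Sum>P1\<in>\<C>. \<Sum>z\<in>P1. (f P' z)\<^sup>2)" by (rule sum_mono)
    then show ?thesis using sum_Z[of "\<lambda>z. (f P' z)\<^sup>2"] card_Z by simp
  qed
  have "(\<Sum>z\<in>V. (f P' z)\<^sup>2) \<le> (1 / 12 - \<delta> / 2) * N"
    using red_clique_sum[OF P'V(1) _ red] P'(2) by simp
  then show ?thesis
    using Y_part Z_part unfolding sum_V N_eq by (simp add: algebra_simps)
qed

end

section \<open>The upper bound\<close>

text \<open>
  The constants are chosen in the order \<open>L\<close>, \<open>L1\<close>, \<open>l0\<close>, each large against its predecessor and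
  \<open>1/\<delta>\<close>. The size \<open>k\<close> of the removed red cliques makes the exceptional vertices of
  \<open>few_blue_between_red_cliques\<close>, for a clique \<open>P'\<close> of size \<open>2L\<close>, at most half of each of them.
\<close>
lemma large_book_exists:
  fixes \<delta> :: real
  assumes \<delta>: "0 < \<delta>" "\<delta> \<le> 1 / 12"
  shows "\<exists>N0. \<forall>(V :: nat set) r. finite V \<and> N0 < card V \<and> symp r \<longrightarrow>
    (\<exists>x\<in>V. \<exists>y\<in>V. r x y \<and> (1 / 12 - \<delta>) * card V < card {z \<in> V. r x z \<and> r y z}) \<or>
    (\<exists>x\<in>V. \<exists>y\<in>V. x \<noteq> y \<and> \<not> r x y \<and>
       (1 / 2 - \<delta>) * card V < card {z \<in> V. \<not> r x z \<and> \<not> r y z})"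
proof -
  define L where "L = nat \<lceil>2 / \<delta>\<rceil> + 2"
  define L1 where "L1 = nat \<lceil>8 * real L / \<delta>\<rceil> + L"
  define l0 where "l0 = nat \<lceil>2 * real L1 / \<delta>\<rceil> + L"
  define k where "k = 2 * (2 ^ (2 * L) * L)"
  have le: "x \<le> \<delta> * real (nat \<lceil>x / \<delta>\<rceil> + j)" for x j
  proof -
    have "x / \<delta> \<le> real (nat \<lceil>x / \<delta>\<rceil> + j)" by linarith
    then show ?thesis using \<delta> by (simp add: field_simps)
  qed
  have k2: "2 * L \<le> k" by (simp add: k_def)
  have k0: "k > 0" by (simp add: k_def L_def)
  obtain RL R1 R0 where R: "ramsey_bound k L RL" "ramsey_bound k L1 R1" "ramsey_bound k l0 R0"
    and R0: "1 \<le> R0"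
    using ramsey_bound_exists by meson
  \<comment> \<open>The first summand yields the assumption \<open>large\<close> of the locale, the second contradicts \<open>bounded_size\<close>.\<close>
  define N0 where "N0 = nat \<lceil>8 * (2 ^ (l0 + L1) * RL) / \<delta>\<rceil> + nat \<lceil>4 * (2 ^ l0 * R1 + R0) / \<delta>\<rceil>"
  show ?thesis
  proof (intro exI[of _ N0] allI impI, rule ccontr)
    fix V :: "nat set" and r
    assume V: "finite V \<and> N0 < card V \<and> symp r"
      and neg: "\<not> ((\<exists>x\<in>V. \<exists>y\<in>V. r x y \<and> (1 / 12 - \<delta>) * card V < card {z \<in> V. r x z \<and> r y z}) \<or>
         (\<exists>x\<in>V. \<exists>y\<in>V. x \<noteq> y \<and> \<not> r x y \<and>
            (1 / 2 - \<delta>) * card V < card {z \<in> V. \<not> r x z \<and> \<not> r y z}))"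
    have N0: "8 * (2 ^ (l0 + L1) * RL) \<le> \<delta> * card V" "4 * (2 ^ l0 * R1 + R0) < \<delta> * card V"
    proof -
      have "8 * (2 ^ (l0 + L1) * RL) / \<delta> \<le> card V" "4 * (2 ^ l0 * R1 + R0) / \<delta> < card V"
        using V unfolding N0_def by linarith+
      then show "8 * (2 ^ (l0 + L1) * RL) \<le> \<delta> * card V" "4 * (2 ^ l0 * R1 + R0) < \<delta> * card V"
        using \<delta> by (simp_all add: field_simps)
    qed
    obtain \<C> where \<C>: "disjoint \<C>" "\<forall>P\<in>\<C>. P \<subseteq> V \<and> P \<noteq> {} \<and> card P = k \<and> homogeneous r P"
      "\<forall>P \<subseteq> V - \<Union>\<C>. P \<noteq> {} \<longrightarrow> \<not> (card P = k \<and> homogeneous r P)"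
      using maximal_disjoint_family[of V "\<lambda>P. card P = k \<and> homogeneous r P"] V by auto
    have no_red: "\<not> (\<exists>Q\<subseteq>U. card Q = k \<and> homogeneous r Q)" if "U \<subseteq> V - \<Union>\<C>" for U
    proof
      assume "\<exists>Q\<subseteq>U. card Q = k \<and> homogeneous r Q"
      then obtain Q where Q: "Q \<subseteq> U" "card Q = k" "homogeneous r Q" by blast
      moreover have "Q \<noteq> {}" using Q(2) k0 by auto
      moreover have "Q \<subseteq> V - \<Union>\<C>" using Q(1) that by (rule order_trans)
      ultimately show False using \<C>(3) by simp
    qed
    have blue: "\<exists>Q\<subseteq>U. card Q = l \<and> homogeneous (\<lambda>x y. \<not> r x y) Q"
      if "ramsey_bound k l R" "U \<subseteq> V - \<Union>\<C>" "R \<le> card U" for U l R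
    proof -
      have "finite U" using V that(2) finite_subset by blast
      then have "(\<exists>Q\<subseteq>U. card Q = k \<and> homogeneous r Q) \<or>
          (\<exists>Q\<subseteq>U. card Q = l \<and> homogeneous (\<lambda>x y. \<not> r x y) Q)"
        using that(1,3) V unfolding ramsey_bound_def by simp
      then show ?thesis using no_red[OF that(2)] by simp
    qed
    interpret split_small_books V r \<delta> L "\<Union>\<C>" "V - \<Union>\<C>" L1 l0 RL R1 R0
    proof unfold_locales
      show "real (card {z \<in> V. r x z \<and> r y z}) \<le> (1 / 12 - \<delta>) * real (card V)"
        if "x \<in> V" "y \<in> V" "r x y" for x y using neg that by (meson not_le)
      show "real (card {z \<in> V. \<not> r x z \<and> \<not> r y z}) \<le> (1 / 2 - \<delta>) * real (card V)"
        if "x \<in> V" "y \<in> V" "x \<noteq> y" "\<not> r x y" for x y using neg that by (meson not_le)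
      show "\<exists>Q\<subseteq>U. card Q = L \<and> homogeneous (\<lambda>x y. \<not> r x y) Q"
        if "U \<subseteq> V - \<Union>\<C>" "RL \<le> card U" for U by (rule blue[OF R(1) that])
      show "\<exists>Q\<subseteq>U. card Q = L1 \<and> homogeneous (\<lambda>x y. \<not> r x y) Q"
        if "U \<subseteq> V - \<Union>\<C>" "R1 \<le> card U" for U by (rule blue[OF R(2) that])
      show "\<exists>Q\<subseteq>U. card Q = l0 \<and> homogeneous (\<lambda>x y. \<not> r x y) Q"
        if "U \<subseteq> V - \<Union>\<C>" "R0 \<le> card U" for U by (rule blue[OF R(3) that])
      show "2 \<le> \<delta> * real L" unfolding L_def by (rule le)
      show "8 * real L \<le> \<delta> * real L1" unfolding L1_def by (rule le)
      show "2 * real L1 \<le> \<delta> * real l0" unfolding l0_def by (rule le)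
      show "real (2 ^ (l0 + L1) * RL) \<le> \<delta> * real (card V) / 8" using N0(1) by simp
    qed (use V \<delta> R0 \<C>(2) in \<open>auto simp: L1_def l0_def\<close>)
    have "\<delta> * real (card V) \<le> 4 * slack"
      by (rule bounded_size[of \<C> k]) (use \<C> k2 in \<open>auto simp: k_def L_def\<close>)
    then show False using N0(2) by (simp add: slack_def)
  qed
qed

text \<open>
  A colouring on \<open>N = (2 + \<epsilon>)n\<close> vertices has an edge with more than \<open>(1/12 - \<delta>)N\<close> common red or
  \<open>(1/2 - \<delta>)N\<close> common blue neighbours. With \<open>\<delta>\<close> small against \<open>\<epsilon>\<close> these numbers exceed \<open>n/6 + 1\<close> and
  \<open>n + 2\<close>; the surplus \<open>1\<close> absorbs the rounding of \<open>n/6\<close>, and the \<open>2\<close> the ends of the edge, which are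
  among the counted blue neighbours.
\<close>
lemma ramsey_books_upper_bound:
  fixes \<epsilon> :: real
  assumes "\<epsilon> > 0"
  shows "\<forall>\<^sub>F n in sequentially. real (ramsey_number (book (nat \<lceil>1 / 6 * real n\<rceil>)) (book n)) \<le> (2 + \<epsilon>) * n"
proof -
  define \<epsilon>' where "\<epsilon>' = min \<epsilon> 1"
  have \<epsilon>': "0 < \<epsilon>'" "\<epsilon>' \<le> 1" "\<epsilon>' \<le> \<epsilon>" using assms by (auto simp: \<epsilon>'_def)
  \<comment> \<open>As \<open>N \<le> 3n\<close>, the loss \<open>\<delta>N\<close> is at most \<open>3\<epsilon>'n/100\<close>, less than the gain \<open>\<epsilon>'n/12\<close> over \<open>2n/12\<close>.\<close>
  define \<delta> where "\<delta> = \<epsilon>' / 100"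
  have \<delta>: "0 < \<delta>" "\<delta> \<le> 1 / 12" using \<epsilon>' by (auto simp: \<delta>_def)
  obtain N0 where N0: "\<forall>(V :: nat set) r. finite V \<and> N0 < card V \<and> symp r \<longrightarrow>
    (\<exists>x\<in>V. \<exists>y\<in>V. r x y \<and> (1 / 12 - \<delta>) * card V < card {z \<in> V. r x z \<and> r y z}) \<or>
    (\<exists>x\<in>V. \<exists>y\<in>V. x \<noteq> y \<and> \<not> r x y \<and>
       (1 / 2 - \<delta>) * card V < card {z \<in> V. \<not> r x z \<and> \<not> r y z})"
    using large_book_exists[OF \<delta>] ..
  define N where "N n = nat \<lfloor>(2 + \<epsilon>') * real n\<rfloor>" for n
  have "\<forall>\<^sub>F n in sequentially. real n \<ge> real N0 + 100 / \<epsilon>'" by real_asymp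
  then show ?thesis
  proof eventually_elim
    case (elim n)
    have n: "real N0 < n" "100 \<le> \<epsilon>' * n"
    proof -
      have "100 / \<epsilon>' > 0" "real N0 \<ge> 0" using \<epsilon>' by auto
      then have "real N0 < n" "100 / \<epsilon>' \<le> n" using elim by linarith+
      then show "real N0 < n" "100 \<le> \<epsilon>' * n" using \<epsilon>' by (simp_all add: field_simps)
    qed
    have "0 \<le> (2 + \<epsilon>') * n" using \<epsilon>' by simp
    then have N: "real (N n) \<le> (2 + \<epsilon>') * n" "(2 + \<epsilon>') * n < real (N n) + 1"
      unfolding N_def by linarith+
    have Nn: "real (N n) \<le> 3 * n" using N(1) \<epsilon>' mult_right_mono[of \<epsilon>' 1 "real n"] by (simp add: algebra_simps)
    have N2: "2 * real n + \<epsilon>' * n - 1 \<le> N n" using N(2) by (simp add: algebra_simps)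
    have \<delta>N: "\<delta> * N n \<le> 3 / 100 * (\<epsilon>' * n)"
      using mult_left_mono[OF Nn, of \<delta>] \<delta> by (simp add: \<delta>_def)
    have red: "real n / 6 + 1 \<le> (1 / 12 - \<delta>) * N n"
      using N2 \<delta>N n(2) by (simp add: algebra_simps)
    have blue: "real n + 2 \<le> (1 / 2 - \<delta>) * N n"
      using N2 \<delta>N n(2) by (simp add: algebra_simps)
    have "arrows (N n) (book (nat \<lceil>1 / 6 * real n\<rceil>)) (book n)"
      unfolding arrows_def
    proof
      fix c
      let ?m = "nat \<lceil>1 / 6 * real n\<rceil>"
      define r where "r x y \<longleftrightarrow> x \<noteq> y \<and> c {x, y} = Red" for x y :: nat
      have "N0 < N n" using n(1) N2 n(2) by linarith
      moreover have "symp r" by (auto simp: r_def symp_def insert_commute)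
      ultimately consider x y where "x < N n" "y < N n" "r x y"
          "(1 / 12 - \<delta>) * N n < card {z \<in> {..<N n}. r x z \<and> r y z}"
        | x y where "x < N n" "y < N n" "x \<noteq> y" "\<not> r x y"
          "(1 / 2 - \<delta>) * N n < card {z \<in> {..<N n}. \<not> r x z \<and> \<not> r y z}"
        using N0[rule_format, of "{..<N n}" r] by auto
      then show "has_copy (book ?m) (colour_class (complete_graph (N n)) c Red) \<or>
            has_copy (book n) (colour_class (complete_graph (N n)) c Blue)"
      proof cases
        case 1
        let ?H = "colour_class (complete_graph (N n)) c Red"
        have "codegree ?H x y = card {z \<in> {..<N n}. r x z \<and> r y z}"
          unfolding codegree_def edges_colour_class_complete r_def using 1(1,2)
          by (intro arg_cong[of _ _ card]) auto
        then have "real n / 6 + 1 \<le> codegree ?H x y" using red 1(4) by linarith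
        then have "?m \<le> codegree ?H x y" by linarith
        moreover have "{x, y} \<in> edges ?H" using 1 by (simp add: edges_colour_class_complete r_def)
        ultimately show ?thesis
          using has_copy_book_iff[OF fin_simple_graph_colour_class_complete] by blast
      next
        case 2
        let ?H = "colour_class (complete_graph (N n)) c Blue"
        have Blue: "c e = Blue" if "c e \<noteq> Red" for e using that by (cases "c e") auto
        have "{z \<in> {..<N n}. \<not> r x z \<and> \<not> r y z}
            \<subseteq> {x, y} \<union> {z. {x, z} \<in> edges ?H \<and> {y, z} \<in> edges ?H}"
          unfolding edges_colour_class_complete r_def using 2(1,2) Blue by auto
        moreover have "finite {z. {x, z} \<in> edges ?H \<and> {y, z} \<in> edges ?H}"
          unfolding edges_colour_class_complete by (rule finite_subset[of _ "{..<N n}"]) auto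
        ultimately have "card {z \<in> {..<N n}. \<not> r x z \<and> \<not> r y z}
            \<le> card ({x, y} \<union> {z. {x, z} \<in> edges ?H \<and> {y, z} \<in> edges ?H})"
          by (intro card_mono) auto
        also have "\<dots> \<le> card {x, y} + codegree ?H x y" unfolding codegree_def by (rule card_Un_le)
        also have "card {x, y} = 2" using 2(3) by simp
        finally have "n \<le> codegree ?H x y" using blue 2(5) by linarith
        moreover have "{x, y} \<in> edges ?H"
          using 2 Blue by (auto simp: edges_colour_class_complete r_def)
        ultimately show ?thesis
          using has_copy_book_iff[OF fin_simple_graph_colour_class_complete] by blast
      qed
    qed
    moreover have "N n > 0" using N2 n \<epsilon>' by linarith
    ultimately have "ramsey_number (book (nat \<lceil>1 / 6 * real n\<rceil>)) (book n) \<le> N n"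
      by (intro ramsey_number_le)
    then have "real (ramsey_number (book (nat \<lceil>1 / 6 * real n\<rceil>)) (book n)) \<le> (2 + \<epsilon>') * n"
      using N(1) by linarith
    also have "\<dots> \<le> (2 + \<epsilon>) * n" using \<epsilon>' by (intro mult_right_mono) auto
    finally show ?case .
  qed
qed

section \<open>The theorem\<close>

lemma smallo_linearI:
  fixes g :: "nat \<Rightarrow> real"
  assumes "\<And>\<epsilon>. \<epsilon> > 0 \<Longrightarrow> \<forall>\<^sub>F n in sequentially. \<bar>g n\<bar> \<le> \<epsilon> * real n"
  shows "g \<in> o(\<lambda>n. real n)"
  by (rule landau_o.smallI) (use assms in simp)

text \<open>
  The number \<open>p\<close> is the smaller root of \<open>(1 - 2\<alpha>)p\<^sup>2 - 2p + 1 - \<alpha> = 0\<close>, which balances the red and the blue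
  constraint in the random colouring.
\<close>
lemma blue_density:
  fixes \<alpha> p :: real
  assumes \<alpha>: "0 < \<alpha>" "\<alpha> < 1 / 2"
    and p: "p = (1 - sqrt (\<alpha> * (3 - 2 * \<alpha>))) / (1 - 2 * \<alpha>)"
  shows "0 \<le> p" "p \<le> 1" "(1 - p)\<^sup>2 = \<alpha> * (1 + 2 * p\<^sup>2)"
proof -
  define q where "q = sqrt (\<alpha> * (3 - 2 * \<alpha>))"
  have "0 \<le> (1 - \<alpha>) * (1 - 2 * \<alpha>)" using \<alpha> by simp
  then have "\<alpha> * (3 - 2 * \<alpha>) \<le> 1" by (simp add: algebra_simps)
  then have "q \<le> 1" by (simp add: q_def)
  then show "0 \<le> p" using \<alpha> by (simp add: p q_def[symmetric])
  have "(2 * \<alpha>)\<^sup>2 \<le> \<alpha> * (3 - 2 * \<alpha>)"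
    using mult_left_mono[of "6 * \<alpha>" 3 \<alpha>] \<alpha> by (simp add: power2_eq_square algebra_simps)
  then have "2 * \<alpha> \<le> q" unfolding q_def by (rule real_le_rsqrt)
  then show "p \<le> 1" using \<alpha> by (simp add: p q_def[symmetric])
  have "q\<^sup>2 = \<alpha> * (3 - 2 * \<alpha>)" using \<alpha> by (simp add: q_def)
  moreover have "q = 1 - p * (1 - 2 * \<alpha>)" using \<alpha> by (simp add: p q_def[symmetric])
  ultimately have "(1 - 2 * \<alpha>) * ((1 - p)\<^sup>2 - \<alpha> * (1 + 2 * p\<^sup>2)) = 0"
    by (simp add: power2_eq_square algebra_simps)
  then show "(1 - p)\<^sup>2 = \<alpha> * (1 + 2 * p\<^sup>2)" using \<alpha> by simp
qed

theorem theorem1p6: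
  fixes \<alpha> p :: real
  assumes "1 / 6 \<le> \<alpha>" and "\<alpha> \<le> (52 - 16 * sqrt 3) / 121"
    and "p = (1 - sqrt (\<alpha> * (3 - 2 * \<alpha>))) / (1 - 2 * \<alpha>)"
  shows "(\<exists>g :: nat \<Rightarrow> real. g \<in> o(\<lambda>n. real n) \<and>
            (\<forall>\<^sub>F n in sequentially.
               real (ramsey_number (book (nat \<lceil>\<alpha> * real n\<rceil>)) (book n))
                 \<ge> 3 * real n / (1 + 2 * p\<^sup>2) - g n))
       \<and> (\<alpha> = 1 / 6 \<longrightarrow>
          (\<exists>g :: nat \<Rightarrow> real. g \<in> o(\<lambda>n. real n) \<and>
            (\<forall>\<^sub>F n in sequentially.
               real (ramsey_number (book (nat \<lceil>\<alpha> * real n\<rceil>)) (book n))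
                 = 3 * real n / (1 + 2 * p\<^sup>2) + g n)))"
proof -
  define R where "R n = real (ramsey_number (book (nat \<lceil>\<alpha> * real n\<rceil>)) (book n))" for n
  define c where "c = 3 / (1 + 2 * p\<^sup>2)"
  have "(52 - 16 * t) / 121 < 1 / 2" if "0 \<le> t" for t :: real
    using that by simp
  from this[of "sqrt 3"] have "(52 - 16 * sqrt 3) / 121 < 1 / 2" by simp
  then have \<alpha>: "0 < \<alpha>" "\<alpha> < 1 / 2" using assms(1,2) by linarith+
  note p = blue_density[OF \<alpha> assms(3)]
  have lower: "\<forall>\<^sub>F n in sequentially. (c - \<epsilon>) * real n \<le> R n" if "\<epsilon> > 0" for \<epsilon>
    unfolding R_def c_def by (rule ramsey_books_lower_bound[OF p(1,2) \<alpha>(1) p(3) that])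
  have first: "\<exists>g. g \<in> o(\<lambda>n. real n) \<and> (\<forall>\<^sub>F n in sequentially. R n \<ge> c * real n - g n)"
  proof (intro exI[of _ "\<lambda>n. max 0 (c * real n - R n)"] conjI smallo_linearI)
    fix \<epsilon> :: real assume \<epsilon>: "\<epsilon> > 0"
    show "\<forall>\<^sub>F n in sequentially. \<bar>max 0 (c * real n - R n)\<bar> \<le> \<epsilon> * real n"
      using lower[OF \<epsilon>] by eventually_elim (use \<epsilon> in \<open>simp add: algebra_simps\<close>)
  next
    show "\<forall>\<^sub>F n in sequentially. c * real n - max 0 (c * real n - R n) \<le> R n"
      by (intro always_eventually allI) linarith
  qed
  have second: "\<exists>g. g \<in> o(\<lambda>n. real n) \<and> (\<forall>\<^sub>F n in sequentially. R n = c * real n + g n)"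
    if \<alpha>6: "\<alpha> = 1 / 6"
  proof (intro exI[of _ "\<lambda>n. R n - c * real n"] conjI smallo_linearI)
    have "sqrt (\<alpha> * (3 - 2 * \<alpha>)) = sqrt ((2 / 3)\<^sup>2)" by (simp add: \<alpha>6 power2_eq_square)
    then have half: "p = 1 / 2" unfolding assms(3) real_sqrt_abs by (simp add: \<alpha>6)
    have c: "c = 2" unfolding c_def half by (simp add: power2_eq_square)
    fix \<epsilon> :: real assume \<epsilon>: "\<epsilon> > 0"
    have "\<forall>\<^sub>F n in sequentially. R n \<le> (2 + \<epsilon>) * n"
      using ramsey_books_upper_bound[OF \<epsilon>] unfolding R_def \<alpha>6 .
    then show "\<forall>\<^sub>F n in sequentially. \<bar>R n - c * real n\<bar> \<le> \<epsilon> * real n"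
      using lower[OF \<epsilon>] by eventually_elim (simp add: c abs_le_iff algebra_simps)
  qed simp
  have "3 * real n / (1 + 2 * p\<^sup>2) = c * real n" for n by (simp add: c_def)
  then show ?thesis using first second unfolding R_def by simp
qed

end
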